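(* Let $\alpha\in\mathbb{R}$ and let $M_\alpha$ be the helicoid in $\mathbb{H}^3$ with angular pitch $\alpha$. If $|\alpha|^2\le\frac98$, then $M_\alpha$ is stable.
   Context: Let $\mathbb{L}^{4}$ be $\mathbb{R}^4$ with the Lorentzian metric $\langle x,y\rangle=-x_1y_1+x_2y_2+x_3y_3+x_4y_4$, and $\mathbb{H}^3=\{x\in\mathbb{L}^4:\langle x,x\rangle=-1,\ x_1\ge1\}$, the hyperbolic space of constant sectional curvature $-1$. The helicoid $M_\alpha\subset\mathbb{H}^3$ with angular pitch $\alpha$ is the minimal surface parametrized by $$X(s,t)=(\cosh s\cosh t,\ \sinh s\cosh t,\ \cos(\alpha s)\sinh t,\ \sin(\alpha s)\sinh t),\qquad (s,t)\in\mathbb{R}^2;$$ it is invariant under the one-parameter group of isometries $\psi_u\circ\varphi_{\alpha u}$, where $\psi_u$ is the translation of distance $u$ along a fixed geodesic $l$ and $\varphi_{u}$ is the rotation of angle $u$ around $l$. A minimal surface $M$ in $\mathbb{H}^3$ with second fundamental form $A$ is called stable if for every compactly supported Lipschitz function $f$ on $M$ $$\int_M |\nabla f|^2-(|A|^2-2)f^2\,dv\ge 0,$$ where $dv$ is the area form of the induced metric. *)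

theory Defs
  imports "HOL-Analysis.Analysis"
begin

definition lorentz :: "real ^ 4 \<Rightarrow> real ^ 4 \<Rightarrow> real" where
  "lorentz x y = - (x $ 1 * y $ 1) + x $ 2 * y $ 2 + x $ 3 * y $ 3 + x $ 4 * y $ 4"

definition hyperbolic_space :: "(real ^ 4) set" where
  "hyperbolic_space = {x. lorentz x x = - 1 \<and> x $ 1 \<ge> 1}"

text \<open>
  Surfaces are given by a global chart \<open>X\<close> on the \<open>(s, t)\<close>-plane. Indices range over the
  two-element type \<open>2\<close>: index \<open>1\<close> belongs to \<open>s\<close> and index \<open>2\<close> (which is also \<open>0\<close>) to \<open>t\<close>.
\<close>

definition coord_vec :: "2 \<Rightarrow> real \<times> real" where
  "coord_vec i = (if i = 1 then (1, 0) else (0, 1))"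

definition partial :: "2 \<Rightarrow> (real \<times> real \<Rightarrow> 'a::real_normed_vector) \<Rightarrow> real \<times> real \<Rightarrow> 'a" where
  "partial i F p = vector_derivative (\<lambda>h. F (p + h *\<^sub>R coord_vec i)) (at 0)"

definition metric :: "(real \<times> real \<Rightarrow> real ^ 4) \<Rightarrow> real \<times> real \<Rightarrow> real ^ 2 ^ 2" where
  "metric X p = (\<chi> i j. lorentz (partial i X p) (partial j X p))"

definition inv_metric :: "(real \<times> real \<Rightarrow> real ^ 4) \<Rightarrow> real \<times> real \<Rightarrow> real ^ 2 ^ 2" where
  "inv_metric X p = matrix_inv (metric X p)"

text \<open>
  Embedded \<open>C\<^sup>2\<close> surfaces in hyperbolic space that are covered by a single chart. The induced
  metric is automatically Riemannian, since tangent spaces of hyperbolic space are spacelike.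
\<close>

definition embedded_surface :: "(real \<times> real \<Rightarrow> real ^ 4) \<Rightarrow> bool" where
  "embedded_surface X \<longleftrightarrow>
     range X \<subseteq> hyperbolic_space \<and>
     X differentiable_on UNIV \<and>
     (\<forall>i. partial i X differentiable_on UNIV) \<and>
     (\<forall>i j. continuous_on UNIV (partial i (partial j X))) \<and>
     (\<forall>p. inj (frechet_derivative X (at p))) \<and>
     (\<exists>Y. homeomorphism UNIV (range X) X Y)"

text \<open>
  The vector-valued second fundamental form \<open>A(\<partial>\<^sub>i, \<partial>\<^sub>j)\<close>: the component of \<open>\<partial>\<^sub>i \<partial>\<^sub>j X\<close> that is
  tangent to hyperbolic space and normal to the surface. As \<open>\<langle>X, X\<rangle> = -1\<close>, the projection to the
  tangent space of hyperbolic space at \<open>X\<close> is \<open>v \<mapsto> v + \<langle>v, X\<rangle> X\<close>.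
\<close>

definition normal_part :: "(real \<times> real \<Rightarrow> real ^ 4) \<Rightarrow> real \<times> real \<Rightarrow> real ^ 4 \<Rightarrow> real ^ 4" where
  "normal_part X p v =
     v + lorentz v (X p) *\<^sub>R X p
       - (\<Sum>k\<in>UNIV. \<Sum>l\<in>UNIV. (inv_metric X p $ k $ l * lorentz v (partial k X p)) *\<^sub>R partial l X p)"

definition second_ff :: "(real \<times> real \<Rightarrow> real ^ 4) \<Rightarrow> real \<times> real \<Rightarrow> 2 \<Rightarrow> 2 \<Rightarrow> real ^ 4" where
  "second_ff X p i j = normal_part X p (partial i (partial j X) p)"

definition second_ff_norm2 :: "(real \<times> real \<Rightarrow> real ^ 4) \<Rightarrow> real \<times> real \<Rightarrow> real" where
  "second_ff_norm2 X p =
     (\<Sum>i\<in>UNIV. \<Sum>j\<in>UNIV. \<Sum>k\<in>UNIV. \<Sum>l\<in>UNIV.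
        inv_metric X p $ i $ k * inv_metric X p $ j $ l *
        lorentz (second_ff X p i j) (second_ff X p k l))"

definition mean_curvature :: "(real \<times> real \<Rightarrow> real ^ 4) \<Rightarrow> real \<times> real \<Rightarrow> real ^ 4" where
  "mean_curvature X p =
     (1 / 2) *\<^sub>R (\<Sum>i\<in>UNIV. \<Sum>j\<in>UNIV. (inv_metric X p $ i $ j) *\<^sub>R second_ff X p i j)"

definition minimal_surface :: "(real \<times> real \<Rightarrow> real ^ 4) \<Rightarrow> bool" where
  "minimal_surface X \<longleftrightarrow> embedded_surface X \<and> (\<forall>p. mean_curvature X p = 0)"

definition curve_length :: "(real \<Rightarrow> real ^ 4) \<Rightarrow> real" where
  "curve_length c =
     integral {0..1} (\<lambda>r. sqrt (lorentz (vector_derivative c (at r)) (vector_derivative c (at r))))"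

text \<open>
  The Riemannian distance of the induced metric on \<open>M\<close>. The curves are \<open>C\<^sup>1\<close> up to the end points,
  so that their length integrals exist; velocity zero is allowed, hence piecewise \<open>C\<^sup>1\<close> curves
  yield the same infimum.
\<close>

definition intrinsic_dist :: "(real ^ 4) set \<Rightarrow> real ^ 4 \<Rightarrow> real ^ 4 \<Rightarrow> real" where
  "intrinsic_dist M x y =
     Inf {curve_length c |c. c C1_differentiable_on {0..1} \<and> c ` {0..1} \<subseteq> M \<and> c 0 = x \<and> c 1 = y}"

text \<open>Only the values of \<open>f\<close> on \<open>M\<close> matter here.\<close>

definition lipschitz_on_surface :: "(real ^ 4) set \<Rightarrow> (real ^ 4 \<Rightarrow> real) \<Rightarrow> bool" where
  "lipschitz_on_surface M f \<longleftrightarrow>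
     (\<exists>L. \<forall>x\<in>M. \<forall>y\<in>M. \<bar>f x - f y\<bar> \<le> L * intrinsic_dist M x y)"

definition compactly_supported_on :: "(real ^ 4) set \<Rightarrow> (real ^ 4 \<Rightarrow> real) \<Rightarrow> bool" where
  "compactly_supported_on M f \<longleftrightarrow> (\<exists>K. compact K \<and> K \<subseteq> M \<and> (\<forall>x\<in>M - K. f x = 0))"

text \<open>
  \<open>|\<nabla>f|\<^sup>2 = g\<^sup>i\<^sup>j \<partial>\<^sub>i(f \<circ> X) \<partial>\<^sub>j(f \<circ> X)\<close>. For Lipschitz \<open>f\<close> the partial derivatives exist almost
  everywhere; elsewhere \<^const>\<open>partial\<close> has an unspecified value, which integrals ignore.
\<close>

definition grad_norm2 ::
    "(real \<times> real \<Rightarrow> real ^ 4) \<Rightarrow> (real ^ 4 \<Rightarrow> real) \<Rightarrow> real \<times> real \<Rightarrow> real" where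
  "grad_norm2 X f p =
     (\<Sum>i\<in>UNIV. \<Sum>j\<in>UNIV. inv_metric X p $ i $ j * partial i (f \<circ> X) p * partial j (f \<circ> X) p)"

text \<open>\<open>\<integral>\<^sub>M u dv\<close> in the chart, with \<open>u\<close> a function of the parameters.\<close>

definition area_integral ::
    "(real \<times> real \<Rightarrow> real ^ 4) \<Rightarrow> (real \<times> real \<Rightarrow> real) \<Rightarrow> real" where
  "area_integral X u = (LINT p|lebesgue. u p * sqrt (det (metric X p)))"

definition stable_minimal_surface :: "(real \<times> real \<Rightarrow> real ^ 4) \<Rightarrow> bool" where
  "stable_minimal_surface X \<longleftrightarrow>
     minimal_surface X \<and>
     (\<forall>f. lipschitz_on_surface (range X) f \<and> compactly_supported_on (range X) f \<longrightarrow>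
        area_integral X (\<lambda>p. grad_norm2 X f p - (second_ff_norm2 X p - 2) * (f (X p))\<^sup>2) \<ge> 0)"

definition helicoid :: "real \<Rightarrow> real \<times> real \<Rightarrow> real ^ 4" where
  "helicoid \<alpha> = (\<lambda>(s, t). vector
     [cosh s * cosh t, sinh s * cosh t, cos (\<alpha> * s) * sinh t, sin (\<alpha> * s) * sinh t])"

end

theory Submission
  imports Defs
begin

text \<open>
  In the chart the induced metric is \<open>w(t)\<^sup>2 ds\<^sup>2 + dt\<^sup>2\<close> with \<open>w\<^sup>2 = cosh\<^sup>2 t + \<alpha>\<^sup>2 sinh\<^sup>2 t\<close>, and
  \<open>|A|\<^sup>2 = 2 \<alpha>\<^sup>2 / w\<^sup>4\<close>. Dropping the derivative along \<open>s\<close>, it suffices to show on every ruling that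
  \<open>\<integral> w f'\<^sup>2 - (2 \<alpha>\<^sup>2 / w\<^sup>3 - 2 w) f\<^sup>2 dt \<ge> 0\<close>. The function \<open>1 / w\<close> is a positive supersolution of the
  associated Jacobi equation as soon as \<open>\<alpha>\<^sup>2 \<le> 3\<close>: since \<open>w'' = w + \<alpha>\<^sup>2 / w\<^sup>3\<close>, the integrand is bounded
  below by \<open>- (w' f\<^sup>2)'\<close>, whose integral vanishes. For Lipschitz \<open>f\<close> this last step needs that
  Lipschitz functions on the line are differentiable almost everywhere, which follows from
  Vitali's covering theorem applied to the Stieltjes measure of a monotone function.
\<close>

section \<open>Lipschitz functions on the real line\<close>

text \<open>A closed interval is the ball about its midpoint with radius half its length, so the
  covering theorem for balls applies to the admissible intervals. Openness of \<open>U\<close> keeps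
  all sufficiently short intervals through a point of \<open>S\<close> inside \<open>U\<close>; this
  localisation allows one covering to be nested in another.\<close>

lemma Vitali_covering_intervals:
  fixes S U :: "real set"
  assumes "open U" "S \<subseteq> U"
    and fine: "\<And>x d. x \<in> S \<Longrightarrow> 0 < d \<Longrightarrow> \<exists>a b. a < b \<and> x \<in> {a..b} \<and> b - a < d \<and> P a b"
  obtains C where "countable C" "\<And>a b. (a, b) \<in> C \<Longrightarrow> a < b \<and> P a b \<and> {a..b} \<subseteq> U"
    "disjoint_family_on (\<lambda>(a, b). {a..b}) C" "negligible (S - (\<Union>(a, b)\<in>C. {a..b}))"
proof -
  define K where "K = {(a, b). a < b \<and> P a b \<and> {a..b} \<subseteq> U}"
  have cball: "cball ((a + b) / 2) ((b - a) / 2) = {a..b}" for a b :: real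
    by (auto simp: cball_eq_atLeastAtMost field_simps)
  obtain C where C: "countable C" "C \<subseteq> K"
     "pairwise (\<lambda>i j. disjnt (cball ((fst i + snd i) / 2) ((snd i - fst i) / 2))
        (cball ((fst j + snd j) / 2) ((snd j - fst j) / 2))) C"
     "negligible (S - (\<Union>i\<in>C. cball ((fst i + snd i) / 2) ((snd i - fst i) / 2)))"
  proof (rule Vitali_covering_theorem_cballs[of K "\<lambda>i. (snd i - fst i) / 2" S "\<lambda>i. (fst i + snd i) / 2"])
    show "0 < (snd i - fst i) / 2" if "i \<in> K" for i
      using that by (auto simp: K_def)
    show "\<exists>i. i \<in> K \<and> x \<in> cball ((fst i + snd i) / 2) ((snd i - fst i) / 2) \<and> (snd i - fst i) / 2 < d"
      if "x \<in> S" "0 < d" for x d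
    proof -
      obtain e where e: "e > 0" "ball x e \<subseteq> U"
        using assms(1,2) \<open>x \<in> S\<close> by (meson open_contains_ball subsetD)
      with fine[of x "min d e"] that obtain a b
        where ab: "a < b" "x \<in> {a..b}" "b - a < min d e" "P a b" by auto
      have "{a..b} \<subseteq> ball x e"
        using ab by (auto simp: dist_real_def)
      with ab e have "(a, b) \<in> K" by (auto simp: K_def)
      moreover have "x \<in> cball ((fst (a, b) + snd (a, b)) / 2) ((snd (a, b) - fst (a, b)) / 2)"
        using ab unfolding fst_conv snd_conv cball by simp
      ultimately show ?thesis using ab by (intro exI[of _ "(a, b)"]) auto
    qed
  qed
  show thesis
  proof
    show "countable C" by fact
    show "a < b \<and> P a b \<and> {a..b} \<subseteq> U" if "(a, b) \<in> C" for a b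
      using that C(2) by (auto simp: K_def)
    show "disjoint_family_on (\<lambda>(a, b). {a..b}) C"
      using C(3) unfolding disjoint_family_on_def pairwise_def disjnt_def cball by (simp add: case_prod_beta)
    show "negligible (S - (\<Union>(a, b)\<in>C. {a..b}))"
      using C(4) by (simp add: cball case_prod_beta)
  qed
qed

text \<open>Continuity of \<open>H\<close> excludes atoms, so a closed interval has Stieltjes mass
  \<open>H b - H a\<close>; countable additivity over the disjoint family carries the bound on each
  interval over to the union. The companion below is the same argument for slopes bounded from
  below.\<close>

lemma interval_measure_covering_le:
  fixes H :: "real \<Rightarrow> real"
  assumes mono: "mono H" and cont: "continuous_on UNIV H"
    and C: "countable C" "\<And>a b. (a, b) \<in> C \<Longrightarrow> a < b" "disjoint_family_on (\<lambda>(a, b). {a..b}) C"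
    and le: "\<And>a b. (a, b) \<in> C \<Longrightarrow> H b - H a \<le> p * (b - a)" and "0 \<le> p"
  shows "emeasure (interval_measure H) (\<Union>(a, b)\<in>C. {a..b}) \<le> p * emeasure lborel (\<Union>(a, b)\<in>C. {a..b})"
proof -
  have eq: "emeasure (interval_measure H) (\<Union>(a, b)\<in>C. {a..b})
      = (\<integral>\<^sup>+i. emeasure (interval_measure H) (case i of (a, b) \<Rightarrow> {a..b}) \<partial>count_space C)"
    using C by (intro emeasure_UN_countable) auto
  have eq': "emeasure lborel (\<Union>(a, b)\<in>C. {a..b})
      = (\<integral>\<^sup>+i. emeasure lborel (case i of (a, b) \<Rightarrow> {a..b}) \<partial>count_space C)"
    using C by (intro emeasure_UN_countable) auto
  show ?thesis
    unfolding eq eq'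
  proof (subst nn_integral_cmult[symmetric], simp, intro nn_integral_mono)
    fix i assume "i \<in> space (count_space C)"
    then obtain a b where i: "i = (a, b)" "(a, b) \<in> C" by (cases i) auto
    have "emeasure (interval_measure H) {a..b} = H b - H a"
      using mono cont C(2)[OF i(2)] by (intro emeasure_interval_measure_Icc) (auto simp: mono_def)
    also have "\<dots> \<le> p * (b - a)" using le i by (simp add: ennreal_leI)
    also have "\<dots> = p * emeasure lborel {a..b}"
      using C(2)[OF i(2)] \<open>0 \<le> p\<close> by (simp add: ennreal_mult)
    finally show "emeasure (interval_measure H) (case i of (a, b) \<Rightarrow> {a..b})
        \<le> p * emeasure lborel (case i of (a, b) \<Rightarrow> {a..b})"
      by (simp add: i)
  qed
qed

lemma interval_measure_covering_ge:
  fixes H :: "real \<Rightarrow> real"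
  assumes mono: "mono H" and cont: "continuous_on UNIV H"
    and C: "countable C" "\<And>a b. (a, b) \<in> C \<Longrightarrow> a < b" "disjoint_family_on (\<lambda>(a, b). {a..b}) C"
    and ge: "\<And>a b. (a, b) \<in> C \<Longrightarrow> H b - H a \<ge> q * (b - a)" and "0 \<le> q"
  shows "q * emeasure lborel (\<Union>(a, b)\<in>C. {a..b}) \<le> emeasure (interval_measure H) (\<Union>(a, b)\<in>C. {a..b})"
proof -
  have eq: "emeasure (interval_measure H) (\<Union>(a, b)\<in>C. {a..b})
      = (\<integral>\<^sup>+i. emeasure (interval_measure H) (case i of (a, b) \<Rightarrow> {a..b}) \<partial>count_space C)"
    using C by (intro emeasure_UN_countable) auto
  have eq': "emeasure lborel (\<Union>(a, b)\<in>C. {a..b})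
      = (\<integral>\<^sup>+i. emeasure lborel (case i of (a, b) \<Rightarrow> {a..b}) \<partial>count_space C)"
    using C by (intro emeasure_UN_countable) auto
  show ?thesis
    unfolding eq eq'
  proof (subst nn_integral_cmult[symmetric], simp, intro nn_integral_mono)
    fix i assume "i \<in> space (count_space C)"
    then obtain a b where i: "i = (a, b)" "(a, b) \<in> C" by (cases i) auto
    have "q * emeasure lborel {a..b} = q * (b - a)"
      using C(2)[OF i(2)] \<open>0 \<le> q\<close> by (simp add: ennreal_mult)
    also have "\<dots> \<le> H b - H a" using ge i by (simp add: ennreal_leI)
    also have "\<dots> = emeasure (interval_measure H) {a..b}"
      using mono cont C(2)[OF i(2)]
      by (intro emeasure_interval_measure_Icc[symmetric]) (auto simp: mono_def)
    finally show "q * emeasure lborel (case i of (a, b) \<Rightarrow> {a..b})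
        \<le> emeasure (interval_measure H) (case i of (a, b) \<Rightarrow> {a..b})"
      by (simp add: i)
  qed
qed

text \<open>Vitali is used twice. Intervals of slope at most \<open>p\<close> inside
  \<open>U\<close> give an open \<open>V\<close> whose Stieltjes mass is at most \<open>p\<close>
  times the length of \<open>U\<close>; intervals of slope at least \<open>q\<close> inside
  \<open>V\<close> then give \<open>W\<close>, and \<open>q\<close> times its length is at most the
  mass of \<open>V\<close>. Each covering misses only a null part of \<open>E\<close>.\<close>

lemma oscillating_slopes_cover:
  fixes H :: "real \<Rightarrow> real"
  assumes mono: "mono H" and cont: "continuous_on UNIV H"
    and pq: "0 \<le> p" "0 \<le> q" and U: "open U" "E \<subseteq> U"
    and low: "\<forall>x\<in>E. \<forall>d>0. \<exists>a b. a < b \<and> x \<in> {a..b} \<and> b - a < d \<and> H b - H a \<le> p * (b - a)"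
    and high: "\<forall>x\<in>E. \<forall>d>0. \<exists>a b. a < b \<and> x \<in> {a..b} \<and> b - a < d \<and> q * (b - a) \<le> H b - H a"
  obtains W where "W \<in> sets borel" "W \<subseteq> U" "negligible (E - W)"
    "q * emeasure lborel W \<le> p * emeasure lborel U"
proof -
  let ?\<mu> = "emeasure (interval_measure H)"
  obtain C where C: "countable C"
    "\<And>a b. (a, b) \<in> C \<Longrightarrow> a < b \<and> H b - H a \<le> p * (b - a) \<and> {a..b} \<subseteq> U"
    "disjoint_family_on (\<lambda>(a, b). {a..b}) C" "negligible (E - (\<Union>(a, b)\<in>C. {a..b}))"
  proof (rule Vitali_covering_intervals[OF U, where P = "\<lambda>a b. H b - H a \<le> p * (b - a)"])
    show "\<exists>a b. a < b \<and> x \<in> {a..b} \<and> b - a < d \<and> H b - H a \<le> p * (b - a)"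
      if "x \<in> E" "0 < d" for x d using low that by blast
  qed (use that in auto)
  \<comment> \<open>The second covering has to live in an open set, so the closed intervals give up
    their endpoints, which are only countably many.\<close>
  define V where "V = (\<Union>(a, b)\<in>C. {a<..<b})"
  have "open V" by (auto simp: V_def)
  have "negligible (\<Union>(a, b)\<in>C. {a, b})"
    using C(1) by (intro negligible_countable_Union) auto
  from negligible_Un[OF C(4) this] have negV: "negligible (E - V)"
    by (rule negligible_subset) (force simp: V_def)
  have borel: "(\<Union>(a, b)\<in>C. {a..b}) \<in> sets borel"
    using C(1) by (intro sets.countable_UN') auto
  have "V \<subseteq> (\<Union>(a, b)\<in>C. {a..b})"
    unfolding V_def by (rule UN_mono) auto
  then have "?\<mu> V \<le> ?\<mu> (\<Union>(a, b)\<in>C. {a..b})"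
    using borel by (intro emeasure_mono) auto
  also have "\<dots> \<le> p * emeasure lborel (\<Union>(a, b)\<in>C. {a..b})"
    using C pq by (intro interval_measure_covering_le[OF mono cont]) auto
  also have "\<dots> \<le> p * emeasure lborel U"
  proof (intro mult_left_mono emeasure_mono)
    show "(\<Union>(a, b)\<in>C. {a..b}) \<subseteq> U" by (rule UN_least) (use C(2) in auto)
  qed (use U(1) in auto)
  finally have V_le: "?\<mu> V \<le> p * emeasure lborel U" .
  obtain D where D: "countable D"
    "\<And>a b. (a, b) \<in> D \<Longrightarrow> a < b \<and> q * (b - a) \<le> H b - H a \<and> {a..b} \<subseteq> V"
    "disjoint_family_on (\<lambda>(a, b). {a..b}) D" "negligible (E \<inter> V - (\<Union>(a, b)\<in>D. {a..b}))"
  proof (rule Vitali_covering_intervals[OF \<open>open V\<close> Int_lower2[of E V],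
        where P = "\<lambda>a b. q * (b - a) \<le> H b - H a"])
    show "\<exists>a b. a < b \<and> x \<in> {a..b} \<and> b - a < d \<and> q * (b - a) \<le> H b - H a"
      if "x \<in> E \<inter> V" "0 < d" for x d using high that by blast
  qed (use that in auto)
  define W where "W = (\<Union>(a, b)\<in>D. {a..b})"
  have W: "W \<in> sets borel"
    unfolding W_def using D(1) by (intro sets.countable_UN') auto
  have "W \<subseteq> V" unfolding W_def by (rule UN_least) (use D(2) in auto)
  have "V \<subseteq> U"
    unfolding V_def
  proof (rule UN_least)
    fix i assume "i \<in> C"
    then obtain a b where "i = (a, b)" "{a..b} \<subseteq> U" using C(2) by (cases i) auto
    then show "(case i of (a, b) \<Rightarrow> {a<..<b}) \<subseteq> U"
      using greaterThanLessThan_subseteq_atLeastAtMost_iff[of a b a b] by auto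
  qed
  have "q * emeasure lborel W \<le> ?\<mu> W"
    unfolding W_def using D pq by (intro interval_measure_covering_ge[OF mono cont]) auto
  also have "\<dots> \<le> ?\<mu> V"
    using \<open>W \<subseteq> V\<close> \<open>open V\<close> by (intro emeasure_mono) auto
  also note V_le
  finally have "q * emeasure lborel W \<le> p * emeasure lborel U" .
  moreover have "negligible (E - W)"
    using negligible_Un[OF negV D(4)] by (rule negligible_subset) (auto simp: W_def)
  ultimately show thesis
    using that W \<open>W \<subseteq> V\<close> \<open>V \<subseteq> U\<close> by blast
qed

section \<open>Null sets of oscillating difference quotients\<close>

text \<open>Let \<open>m\<close> be the outer measure of \<open>E\<close>, taken over open supersets
  since \<open>E\<close> is not known to be measurable. The covering set \<open>W\<close> has length
  at least \<open>m\<close>, so \<open>q * m\<close> is at most \<open>p\<close> times the length of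
  every open superset, hence at most \<open>p * m\<close>; as \<open>m\<close> is finite and
  \<open>p < q\<close>, it is zero.\<close>

lemma negligible_oscillating_slopes_bounded:
  fixes H :: "real \<Rightarrow> real"
  assumes mono: "mono H" and cont: "continuous_on UNIV H"
    and pq: "0 \<le> p" "p < q" and "bounded E"
    and low: "\<forall>x\<in>E. \<forall>d>0. \<exists>a b. a < b \<and> x \<in> {a..b} \<and> b - a < d \<and> H b - H a \<le> p * (b - a)"
    and high: "\<forall>x\<in>E. \<forall>d>0. \<exists>a b. a < b \<and> x \<in> {a..b} \<and> b - a < d \<and> q * (b - a) \<le> H b - H a"
  shows "negligible E"
proof -
  have q: "0 < q" using pq by simp
  define m where "m = (INF U\<in>{U. open U \<and> E \<subseteq> U}. emeasure lborel U)"
  have m_le: "m \<le> emeasure lborel U" if "open U" "E \<subseteq> U" for U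
    unfolding m_def using that by (intro INF_lower) auto
  have shrink: "q * m \<le> p * emeasure lborel U" if U: "open U" "E \<subseteq> U" for U
  proof -
    obtain W where W: "W \<in> sets borel" "W \<subseteq> U" "negligible (E - W)"
      "q * emeasure lborel W \<le> p * emeasure lborel U"
      using oscillating_slopes_cover[OF mono cont pq(1) less_imp_le[OF q] U low high] .
    have "m \<le> emeasure lborel W"
    proof (rule ennreal_le_epsilon)
      fix e :: real assume "0 < e"
      \<comment> \<open>\<open>E\<close> alone may fail to be measurable, but
        \<open>W \<union> E\<close> differs from the Borel set \<open>W\<close> by the null set
        \<open>E - W\<close>, and so has an open superset of almost the same measure as
        \<open>W\<close>.\<close>
      have "W \<union> E \<in> sets lebesgue"
        using negligible_imp_sets[OF W(3)] W(1)
        by (metis Un_Diff_cancel sets.Un sets_completionI_sets sets_lborel)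
      then obtain T where T: "open T" "W \<union> E \<subseteq> T" "emeasure lebesgue (T - (W \<union> E)) < e"
        using sets_lebesgue_outer_open[OF _ \<open>0 < e\<close>] by metis
      have "m \<le> emeasure lebesgue T" using m_le T by simp
      also have "\<dots> \<le> emeasure lebesgue ((W \<union> (E - W)) \<union> (T - (W \<union> E)))"
        using W(1) T(1) \<open>W \<union> E \<in> sets lebesgue\<close> by (intro emeasure_mono) auto
      also have "\<dots> \<le> emeasure lebesgue (W \<union> (E - W)) + emeasure lebesgue (T - (W \<union> E))"
        using W(1) T(1) \<open>W \<union> E \<in> sets lebesgue\<close> by (intro emeasure_subadditive) auto
      also have "emeasure lebesgue (W \<union> (E - W)) = emeasure lebesgue W"
        using W(1,3) by (intro emeasure_Un_null_set) (auto simp: negligible_iff_null_sets)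
      also have "\<dots> = emeasure lborel W" using W(1) by simp
      also have "emeasure lborel W + emeasure lebesgue (T - (W \<union> E)) \<le> emeasure lborel W + e"
        using T(3) by (intro add_left_mono) simp
      finally show "m \<le> emeasure lborel W + e" .
    qed
    then have "q * m \<le> q * emeasure lborel W" by (intro mult_left_mono) auto
    with W(4) show ?thesis by simp
  qed
  obtain B where B: "E \<subseteq> ball (0::real) B" using bounded_subset_ballD[OF \<open>bounded E\<close>] by metis
  have "m \<le> emeasure lborel (ball (0::real) B)" by (rule m_le[OF open_ball B])
  also have "\<dots> < \<infinity>" using emeasure_bounded_finite[OF bounded_ball] by simp
  finally have fin: "m < \<infinity>" .
  then obtain r where r: "0 \<le> r" "m = ennreal r" by (cases m) auto
  have "r = 0"
  proof (rule ccontr)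
    assume "r \<noteq> 0"
    \<comment> \<open>\<open>s\<close> exceeds \<open>r\<close> by so little that
      \<open>p * s < q * r\<close> survives: \<open>p\<close> times the increment is at most
      \<open>(q - p) * r / 2\<close>. An open superset of length below \<open>s\<close> then
      contradicts \<open>shrink\<close>.\<close>
    define s where "s = r + (q - p) * r / (2 * q)"
    have "r < s" using \<open>r \<noteq> 0\<close> r pq q by (simp add: s_def)
    have "p * ((q - p) * r / (2 * q)) \<le> q * ((q - p) * r / (2 * q))"
      using pq r by (intro mult_right_mono) auto
    also have "\<dots> = (q - p) * r / 2" using q by simp
    also have "\<dots> < (q - p) * r" using \<open>r \<noteq> 0\<close> r pq by simp
    finally have "p * s < q * r" by (simp add: s_def algebra_simps)
    have "m < ennreal s" using r \<open>r < s\<close> by (simp add: ennreal_lessI)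
    then obtain U where U: "open U" "E \<subseteq> U" "emeasure lborel U < ennreal s"
      unfolding m_def by (auto simp: INF_less_iff)
    have "ennreal (q * r) = q * m" using r q by (simp add: ennreal_mult)
    also have "\<dots> \<le> p * emeasure lborel U" by (rule shrink[OF U(1,2)])
    also have "\<dots> \<le> p * ennreal s" using U by (intro mult_left_mono) auto
    also have "\<dots> = ennreal (p * s)" using pq r \<open>r < s\<close> by (simp add: ennreal_mult)
    finally show False using \<open>p * s < q * r\<close> pq r \<open>r < s\<close> by (simp add: ennreal_le_iff)
  qed
  then have "m = 0" using r by simp
  show ?thesis
    unfolding negligible_outer
  proof (intro allI impI)
    fix e :: real assume "0 < e"
    with \<open>m = 0\<close> have "m < ennreal e" by simp
    then obtain U where U: "open U" "E \<subseteq> U" "emeasure lborel U < ennreal e"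
      unfolding m_def by (auto simp: INF_less_iff)
    have "U \<in> lmeasurable"
      using U by (intro fmeasurableI) (auto simp: top.not_eq_extremum intro: less_trans)
    moreover have "measure lebesgue U < e"
      using U \<open>0 < e\<close>
      by (cases "emeasure lborel U") (auto simp: measure_def ennreal_less_iff)
    ultimately show "\<exists>T. E \<subseteq> T \<and> T \<in> lmeasurable \<and> measure lebesgue T < e" using U by blast
  qed
qed

text \<open>For negative \<open>p\<close> the set is empty, as slopes of a monotone function are
  nonnegative. Otherwise the line is exhausted by balls, and difference quotients are read as slopes
  of short intervals with \<open>x\<close> as an endpoint.\<close>

lemma negligible_oscillating_slopes:
  fixes H :: "real \<Rightarrow> real"
  assumes mono: "mono H" and cont: "continuous_on UNIV H" and "p < q"
  shows "negligible {x. (\<exists>\<^sub>F y in at x. (H y - H x) / (y - x) < p) \<and>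
    (\<exists>\<^sub>F y in at x. q < (H y - H x) / (y - x))}" (is "negligible ?E")
proof (cases "0 \<le> p")
  case False
  have "(H y - H x) / (y - x) \<ge> 0" for x y
    using mono by (cases "x \<le> y") (auto simp: mono_def zero_le_divide_iff)
  then have "\<not> (H y - H x) / (y - x) < p" for x y
    using False by (meson dual_order.strict_trans2 le_less not_le)
  then show ?thesis by simp
next
  case True
  have slope: "\<exists>a b. a < b \<and> x \<in> {a..b} \<and> b - a < d \<and> Q ((H b - H a) / (b - a))"
    if freq: "\<exists>\<^sub>F y in at x. Q ((H y - H x) / (y - x))" and "0 < d" for x d and Q :: "real \<Rightarrow> bool"
  proof -
    have "\<forall>\<^sub>F y in at x. y \<noteq> x \<and> dist y x < d"
      using \<open>0 < d\<close> by (auto simp: eventually_at)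
    from frequently_eventually_frequently[OF freq this]
    obtain y where y: "Q ((H y - H x) / (y - x))" "y \<noteq> x" "dist y x < d"
      by (auto dest: frequently_ex)
    \<comment> \<open>Swapping the endpoints leaves the quotient unchanged, so \<open>y\<close> may
      lie on either side of \<open>x\<close>.\<close>
    have "(H y - H x) / (y - x) = (H x - H y) / (x - y)"
      by (metis minus_diff_eq minus_divide_divide)
    with y have "Q ((H x - H y) / (x - y))" by simp
    show ?thesis
    proof (cases "x < y")
      case True
      with y show ?thesis by (intro exI[of _ x] exI[of _ y]) (auto simp: dist_real_def)
    next
      case False
      with y \<open>Q ((H x - H y) / (x - y))\<close> show ?thesis
        by (intro exI[of _ y] exI[of _ x]) (auto simp: dist_real_def)
    qed
  qed
  have "negligible (?E \<inter> ball 0 (real n))" for n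
  proof (rule negligible_oscillating_slopes_bounded[OF mono cont True \<open>p < q\<close>])
    show "bounded (?E \<inter> ball 0 (real n))" by (meson bounded_Int bounded_ball)
    show "\<forall>x\<in>?E \<inter> ball 0 (real n). \<forall>d>0. \<exists>a b. a < b \<and> x \<in> {a..b} \<and> b - a < d \<and> H b - H a \<le> p * (b - a)"
    proof (intro ballI allI impI)
      fix x d :: real assume "x \<in> ?E \<inter> ball 0 (real n)" "0 < d"
      with slope[where x = x and d = d and Q = "\<lambda>z. z < p"] obtain a b
        where "a < b" "x \<in> {a..b}" "b - a < d" "(H b - H a) / (b - a) < p" by blast
      then show "\<exists>a b. a < b \<and> x \<in> {a..b} \<and> b - a < d \<and> H b - H a \<le> p * (b - a)"
        by (intro exI[of _ a] exI[of _ b]) (simp add: divide_less_eq)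
    qed
    show "\<forall>x\<in>?E \<inter> ball 0 (real n). \<forall>d>0. \<exists>a b. a < b \<and> x \<in> {a..b} \<and> b - a < d \<and> q * (b - a) \<le> H b - H a"
    proof (intro ballI allI impI)
      fix x d :: real assume "x \<in> ?E \<inter> ball 0 (real n)" "0 < d"
      with slope[where x = x and d = d and Q = "\<lambda>z. q < z"] obtain a b
        where "a < b" "x \<in> {a..b}" "b - a < d" "q < (H b - H a) / (b - a)" by blast
      then show "\<exists>a b. a < b \<and> x \<in> {a..b} \<and> b - a < d \<and> q * (b - a) \<le> H b - H a"
        by (intro exI[of _ a] exI[of _ b]) (simp add: less_divide_eq)
    qed
  qed
  then have "negligible (\<Union>n. ?E \<inter> ball 0 (real n))"
    by (intro negligible_countable_Union) auto
  moreover have "(\<Union>n. ?E \<inter> ball 0 (real n)) = ?E"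
    using reals_Archimedean2 by auto
  ultimately show ?thesis by simp
qed

section \<open>Differentiability almost everywhere and the integral of the derivative\<close>

text \<open>The limit is the supremum of the eventual lower bounds. No rational above it is an
  eventual lower bound, so by \<open>no\<close> every still larger rational is an eventual upper
  bound. Rational levels keep the exceptional set of the application a countable union.\<close>

lemma convergent_of_no_oscillation:
  fixes f :: "'a \<Rightarrow> real"
  assumes bnd: "\<forall>\<^sub>F y in F. \<bar>f y\<bar> \<le> B" and "F \<noteq> bot"
    and no: "\<And>p q. p \<in> \<rat> \<Longrightarrow> q \<in> \<rat> \<Longrightarrow> p < q \<Longrightarrow> (\<forall>\<^sub>F y in F. p \<le> f y) \<or> (\<forall>\<^sub>F y in F. f y \<le> q)"
  shows "\<exists>l. (f \<longlongrightarrow> l) F"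
proof -
  define A where "A = {p. \<forall>\<^sub>F y in F. p \<le> f y}"
  have "-B \<in> A" unfolding A_def using bnd by (auto elim: eventually_mono)
  have "p \<le> B" if "p \<in> A" for p
  proof -
    have "\<forall>\<^sub>F y in F. p \<le> B"
      using bnd that[unfolded A_def mem_Collect_eq] by eventually_elim auto
    with \<open>F \<noteq> bot\<close> show ?thesis by (simp add: eventually_const_iff)
  qed
  then have "bdd_above A" by (auto simp: bdd_above_def)
  have "(f \<longlongrightarrow> Sup A) F"
  proof (rule order_tendstoI)
    fix a assume "a < Sup A"
    then obtain p where "p \<in> A" "a < p"
      using less_cSup_iff[of A a] \<open>-B \<in> A\<close> \<open>bdd_above A\<close> by auto
    then show "\<forall>\<^sub>F y in F. a < f y" unfolding A_def by (auto elim: eventually_mono)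
  next
    fix a assume "Sup A < a"
    then obtain q where q: "q \<in> \<rat>" "Sup A < q" "q < a" using Rats_dense_in_real by blast
    then obtain p where p: "p \<in> \<rat>" "Sup A < p" "p < q" using Rats_dense_in_real by blast
    have "p \<notin> A" using cSup_upper[of p A] \<open>bdd_above A\<close> p by auto
    then have "\<forall>\<^sub>F y in F. f y \<le> q" using no[OF p(1) q(1) p(3)] by (auto simp: A_def)
    with q(3) show "\<forall>\<^sub>F y in F. f y < a" by (auto elim: eventually_mono)
  qed
  then show ?thesis ..
qed

text \<open>Adding \<open>L * x\<close> makes \<open>g\<close> monotone without affecting
  differentiability, so the Stieltjes argument applies to the sum. Its difference quotients are
  bounded; where they fail to converge, they oscillate across some rational pair
  \<open>p < q\<close>.\<close>

theorem negligible_not_differentiable_lipschitz: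
  fixes g :: "real \<Rightarrow> real"
  assumes "L-lipschitz_on UNIV g"
  shows "negligible {x. \<not> g differentiable (at x)}"
proof -
  define H where "H x = g x + L * x" for x
  have g: "\<bar>g x - g y\<bar> \<le> L * \<bar>x - y\<bar>" for x y
    using lipschitz_onD[OF assms, of x y] by (simp add: dist_real_def)
  have mono: "mono H"
  proof
    fix x y :: real assume "x \<le> y"
    with g[of x y] have "g x - g y \<le> L * (y - x)" by simp
    then show "H x \<le> H y" by (simp add: H_def algebra_simps)
  qed
  have cont: "continuous_on UNIV H"
    unfolding H_def by (intro continuous_intros lipschitz_on_continuous_on[OF assms])
  let ?E = "\<lambda>p q. {x. (\<exists>\<^sub>F y in at x. (H y - H x) / (y - x) < p) \<and>
    (\<exists>\<^sub>F y in at x. q < (H y - H x) / (y - x))}"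
  have "negligible (\<Union>p\<in>\<rat>. \<Union>q\<in>\<rat> \<inter> {p<..}. ?E p q)"
  proof (intro negligible_countable_Union countable_image countable_Int1 countable_rat; clarsimp)
    fix p :: real
    show "negligible (\<Union>q\<in>\<rat> \<inter> {p<..}. ?E p q)"
      using negligible_oscillating_slopes[OF mono cont]
      by (intro negligible_countable_Union countable_image countable_Int1 countable_rat) auto
  qed
  moreover have "{x. \<not> g differentiable (at x)} \<subseteq> (\<Union>p\<in>\<rat>. \<Union>q\<in>\<rat> \<inter> {p<..}. ?E p q)"
  proof (rule ccontr)
    assume "\<not> ?thesis"
    then obtain x where x: "\<not> g differentiable (at x)"
      "x \<notin> (\<Union>p\<in>\<rat>. \<Union>q\<in>\<rat> \<inter> {p<..}. ?E p q)" by blast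
    have "\<exists>l. ((\<lambda>y. (H y - H x) / (y - x)) \<longlongrightarrow> l) (at x)"
    proof (rule convergent_of_no_oscillation)
      have "\<bar>(H y - H x) / (y - x)\<bar> \<le> 2 * \<bar>L\<bar>" if "y \<noteq> x" for y
      proof -
        have "\<bar>H y - H x\<bar> \<le> \<bar>g y - g x\<bar> + \<bar>L * (y - x)\<bar>"
          by (simp add: H_def algebra_simps)
        also have "\<dots> \<le> 2 * \<bar>L\<bar> * \<bar>y - x\<bar>"
          using g[of y x] lipschitz_on_nonneg[OF assms] by (simp add: abs_mult)
        finally show ?thesis using that by (simp add: divide_le_eq)
      qed
      then show "\<forall>\<^sub>F y in at x. \<bar>(H y - H x) / (y - x)\<bar> \<le> 2 * \<bar>L\<bar>"
        unfolding eventually_at_topological by auto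
      show "(\<forall>\<^sub>F y in at x. p \<le> (H y - H x) / (y - x)) \<or> (\<forall>\<^sub>F y in at x. (H y - H x) / (y - x) \<le> q)"
        if "p \<in> \<rat>" "q \<in> \<rat>" "p < q" for p q
        using x(2) that by (fastforce simp: frequently_def not_less)
    qed simp
    then obtain l where "((\<lambda>y. (H y - H x) / (y - x)) \<longlongrightarrow> l) (at x)" ..
    then have "(H has_real_derivative l) (at x)" by (simp add: has_field_derivative_iff)
    then have "((\<lambda>y. H y - L * y) has_real_derivative l - L) (at x)"
      by (auto intro!: derivative_eq_intros)
    then have "(g has_real_derivative l - L) (at x)" by (simp add: H_def)
    with x(1) show False using real_differentiable_def by blast
  qed
  ultimately show ?thesis by (rule negligible_subset)
qed

text \<open>The difference quotients \<open>Q n\<close> integrate to zero by translation invariance,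
  are dominated by a multiple of an indicator, and converge almost everywhere to the derivative;
  dominated convergence passes to the limit. This is what makes boundary terms vanish later
  on.\<close>

lemma lipschitz_compact_support_derivative:
  fixes g :: "real \<Rightarrow> real"
  assumes lip: "L-lipschitz_on UNIV g" and supp: "\<And>x. R < \<bar>x\<bar> \<Longrightarrow> g x = 0"
  obtains D where "integrable lborel D" "AE x in lborel. (g has_real_derivative D x) (at x)"
    "(\<integral>x. D x \<partial>lborel) = 0"
proof -
  define Q where "Q n x = (g (x + inverse (Suc n)) - g x) / inverse (Suc n)" for n :: nat and x
  \<comment> \<open>A limit along one fixed sequence is Borel measurable on the whole line, and it
    equals the derivative wherever that exists.\<close>
  define D where "D x = lim (\<lambda>n. Q n x)" for x
  have [measurable]: "g \<in> borel_measurable borel"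
    using lipschitz_on_continuous_on[OF lip] by (rule borel_measurable_continuous_onI)
  have [measurable]: "Q n \<in> borel_measurable borel" for n unfolding Q_def by measurable
  have [measurable]: "D \<in> borel_measurable borel" unfolding D_def by measurable
  have "L \<ge> 0" by (rule lipschitz_on_nonneg[OF lip])
  have "{x. \<not> g differentiable (at x)} \<in> null_sets lebesgue"
    using negligible_not_differentiable_lipschitz[OF lip] by (simp add: negligible_iff_null_sets)
  then have "AE x in lebesgue. g differentiable (at x)"
    by (auto simp: eventually_ae_filter)
  then have diff: "AE x in lborel. g differentiable (at x)"
    by (simp add: AE_completion_iff)
  have lims: "(\<lambda>n. Q n x) \<longlonglongrightarrow> l" if "(g has_real_derivative l) (at x)" for x l
  proof -
    have "filterlim (\<lambda>n. inverse (real (Suc n))) (at 0) sequentially"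
      by (intro filterlim_atI LIMSEQ_inverse_real_of_nat) auto
    from filterlim_compose[OF that[unfolded DERIV_def] this]
    show ?thesis by (simp add: Q_def)
  qed
  have deriv: "AE x in lborel. (g has_real_derivative D x) (at x)"
    using diff
  proof eventually_elim
    case (elim x)
    then obtain l where l: "(g has_real_derivative l) (at x)" using real_differentiable_def by blast
    from lims[OF this] have "D x = l" by (simp add: D_def limI)
    with l show ?case by simp
  qed
  have gint: "integrable lborel g"
  proof -
    have "integrable lborel (\<lambda>x. indicator {-R..R} x *\<^sub>R g x)"
      by (intro borel_integrable_compact) (auto intro: continuous_on_subset lipschitz_on_continuous_on[OF lip])
    moreover have "(\<lambda>x. indicator {-R..R} x *\<^sub>R g x) = g"
      using supp by (force simp: indicator_def)
    ultimately show ?thesis by simp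
  qed
  have shift: "integrable lborel (\<lambda>x. g (x + c))" "(\<integral>x. g (x + c) \<partial>lborel) = (\<integral>x. g x \<partial>lborel)" for c
    using lborel_integrable_real_affine[OF gint, of 1 c] lborel_integral_real_affine[of 1 g c]
    by (simp_all add: add.commute)
  have Q0: "(\<integral>x. Q n x \<partial>lborel) = 0" for n
    unfolding Q_def using gint shift by simp
  \<comment> \<open>The steps have length at most 1, so \<open>Q n\<close> vanishes outside the
    support interval enlarged by 1.\<close>
  let ?w = "\<lambda>x. L * indicator {-R - 1..R + 1} x :: real"
  have dom: "norm (Q n x) \<le> ?w x" for n x
  proof (cases "x \<in> {-R - 1..R + 1}")
    case True
    have "\<bar>g (x + inverse (Suc n)) - g x\<bar> \<le> L * inverse (Suc n)"
      using lipschitz_onD[OF lip, of "x + inverse (Suc n)" x] by (simp add: dist_real_def)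
    then have "\<bar>Q n x\<bar> \<le> L"
      unfolding Q_def abs_divide by (simp add: divide_le_eq del: of_nat_Suc)
    then show ?thesis using True by simp
  next
    case False
    have "inverse (real (Suc n)) \<le> 1" "0 < inverse (real (Suc n))" by (simp_all add: field_simps)
    with False have "R < \<bar>x + inverse (real (Suc n))\<bar>" "R < \<bar>x\<bar>"
      unfolding atLeastAtMost_iff by arith+
    then have "Q n x = 0" using supp by (simp add: Q_def)
    then show ?thesis using \<open>L \<ge> 0\<close> by simp
  qed
  have lim: "AE x in lborel. (\<lambda>n. Q n x) \<longlonglongrightarrow> D x"
    using deriv by eventually_elim (rule lims)
  have wint: "integrable lborel ?w"
    by (intro integrable_mult_right) (simp add: integrable_indicator_iff emeasure_lborel_Icc_eq)
  have "integrable lborel D"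
    by (rule integrable_dominated_convergence[OF _ _ wint lim]) (use dom in auto)
  moreover have "(\<lambda>n. \<integral>x. Q n x \<partial>lborel) \<longlonglongrightarrow> (\<integral>x. D x \<partial>lborel)"
    by (rule integral_dominated_convergence[OF _ _ wint lim]) (use dom in auto)
  then have "(\<integral>x. D x \<partial>lborel) = 0" by (simp add: Q0 LIMSEQ_const_iff)
  ultimately show thesis using that deriv by blast
qed


section \<open>Geometry of the helicoid\<close>

lemma vector4_nth [simp]:
  "(vector [a, b, c, d] :: 'a::zero ^ 4) $ 1 = a"
  "(vector [a, b, c, d] :: 'a::zero ^ 4) $ 2 = b"
  "(vector [a, b, c, d] :: 'a::zero ^ 4) $ 3 = c"
  "(vector [a, b, c, d] :: 'a::zero ^ 4) $ 4 = d"
  by (simp_all add: vector_def)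

text \<open>Expansion in the standard basis makes the rules for sums and scalar multiples available
  for derivatives and continuity of tuples.\<close>

lemma vector4_conv: "(vector [a, b, c, d] :: real ^ 4) =
    a *\<^sub>R axis 1 1 + b *\<^sub>R axis 2 1 + c *\<^sub>R axis 3 1 + d *\<^sub>R axis 4 1"
  by (simp add: vec_eq_iff forall_4 axis_def)

lemma has_derivative_vector4:
  assumes "(f has_derivative f') (at x within S)" "(g has_derivative g') (at x within S)"
    "(h has_derivative h') (at x within S)" "(k has_derivative k') (at x within S)"
  shows "((\<lambda>x. vector [f x, g x, h x, k x] :: real ^ 4) has_derivative
    (\<lambda>y. vector [f' y, g' y, h' y, k' y])) (at x within S)"
  unfolding vector4_conv by (intro has_derivative_add has_derivative_scaleR_left assms)

lemma has_vector_derivative_vector4: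
  assumes "(f has_real_derivative f') (at x)" "(g has_real_derivative g') (at x)"
    "(h has_real_derivative h') (at x)" "(k has_real_derivative k') (at x)"
  shows "((\<lambda>x. vector [f x, g x, h x, k x] :: real ^ 4) has_vector_derivative
    vector [f', g', h', k']) (at x)"
proof -
  have "(\<lambda>y. vector [f' * y, g' * y, h' * y, k' * y] :: real ^ 4) = (\<lambda>y. y *\<^sub>R vector [f', g', h', k'])"
    by (simp add: fun_eq_iff vec_eq_iff forall_4)
  then show ?thesis
    using has_derivative_vector4[OF assms[unfolded has_field_derivative_def]]
    by (simp add: has_vector_derivative_def)
qed

lemma continuous_on_vector4 [continuous_intros]:
  assumes "continuous_on S f" "continuous_on S g" "continuous_on S h" "continuous_on S k"
  shows "continuous_on S (\<lambda>x. vector [f x, g x, h x, k x] :: real ^ 4)"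
  unfolding vector4_conv by (intro continuous_intros assms)

lemma partial_1_eqI:
  assumes "((\<lambda>x. F (x, t)) has_vector_derivative D) (at s)"
  shows "partial 1 F (s, t) = D"
proof -
  have "((\<lambda>h. s + h) has_vector_derivative 1) (at 0)" by (auto intro!: derivative_eq_intros)
  from vector_diff_chain_at[OF this, of "\<lambda>x. F (x, t)" D] assms
  have "((\<lambda>h. F (s + h, t)) has_vector_derivative D) (at 0)" by (simp add: o_def)
  then show ?thesis
    by (simp add: partial_def coord_vec_def vector_derivative_at)
qed

lemma partial_2_eqI:
  assumes "((\<lambda>y. F (s, y)) has_vector_derivative D) (at t)"
  shows "partial 2 F (s, t) = D"
proof -
  have "((\<lambda>h. t + h) has_vector_derivative 1) (at 0)" by (auto intro!: derivative_eq_intros)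
  from vector_diff_chain_at[OF this, of "\<lambda>y. F (s, y)" D] assms
  have "((\<lambda>h. F (s, t + h)) has_vector_derivative D) (at 0)" by (simp add: o_def)
  then show ?thesis
    by (simp add: partial_def coord_vec_def vector_derivative_at)
qed

text \<open>Closed forms of the partial derivatives of the chart. The second derivative in
  \<open>t\<close> gets no name of its own: it is the helicoid again, as the rulings are unit speed
  geodesics of hyperbolic space.\<close>

definition helicoid_s :: "real \<Rightarrow> real \<times> real \<Rightarrow> real ^ 4" where
  "helicoid_s \<alpha> = (\<lambda>(s, t). vector
     [sinh s * cosh t, cosh s * cosh t, - \<alpha> * sin (\<alpha> * s) * sinh t, \<alpha> * cos (\<alpha> * s) * sinh t])"

definition helicoid_t :: "real \<Rightarrow> real \<times> real \<Rightarrow> real ^ 4" where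
  "helicoid_t \<alpha> = (\<lambda>(s, t). vector
     [cosh s * sinh t, sinh s * sinh t, cos (\<alpha> * s) * cosh t, sin (\<alpha> * s) * cosh t])"

definition helicoid_ss :: "real \<Rightarrow> real \<times> real \<Rightarrow> real ^ 4" where
  "helicoid_ss \<alpha> = (\<lambda>(s, t). vector
     [cosh s * cosh t, sinh s * cosh t, - \<alpha>\<^sup>2 * cos (\<alpha> * s) * sinh t, - \<alpha>\<^sup>2 * sin (\<alpha> * s) * sinh t])"

definition helicoid_st :: "real \<Rightarrow> real \<times> real \<Rightarrow> real ^ 4" where
  "helicoid_st \<alpha> = (\<lambda>(s, t). vector
     [sinh s * sinh t, cosh s * sinh t, - \<alpha> * sin (\<alpha> * s) * cosh t, \<alpha> * cos (\<alpha> * s) * cosh t])"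

lemmas helicoid_defs = helicoid_def helicoid_s_def helicoid_t_def helicoid_ss_def helicoid_st_def

lemma helicoid_has_derivative_1:
  "((\<lambda>s. helicoid \<alpha> (s, t)) has_vector_derivative helicoid_s \<alpha> (s, t)) (at s)"
  "((\<lambda>s. helicoid_s \<alpha> (s, t)) has_vector_derivative helicoid_ss \<alpha> (s, t)) (at s)"
  "((\<lambda>s. helicoid_t \<alpha> (s, t)) has_vector_derivative helicoid_st \<alpha> (s, t)) (at s)"
  unfolding helicoid_defs split
  by (rule has_vector_derivative_vector4;
      (auto intro!: derivative_eq_intros simp: power2_eq_square)[1])+

lemma helicoid_has_derivative_2:
  "((\<lambda>t. helicoid \<alpha> (s, t)) has_vector_derivative helicoid_t \<alpha> (s, t)) (at t)"
  "((\<lambda>t. helicoid_s \<alpha> (s, t)) has_vector_derivative helicoid_st \<alpha> (s, t)) (at t)"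
  "((\<lambda>t. helicoid_t \<alpha> (s, t)) has_vector_derivative helicoid \<alpha> (s, t)) (at t)"
  unfolding helicoid_defs split
  by (rule has_vector_derivative_vector4;
      (auto intro!: derivative_eq_intros simp: power2_eq_square)[1])+

lemma partial_helicoid [simp]:
  "partial 1 (helicoid \<alpha>) = helicoid_s \<alpha>" "partial 2 (helicoid \<alpha>) = helicoid_t \<alpha>"
  "partial 1 (helicoid_s \<alpha>) = helicoid_ss \<alpha>" "partial 2 (helicoid_s \<alpha>) = helicoid_st \<alpha>"
  "partial 1 (helicoid_t \<alpha>) = helicoid_st \<alpha>" "partial 2 (helicoid_t \<alpha>) = helicoid \<alpha>"
  by (auto intro!: ext partial_1_eqI partial_2_eqI helicoid_has_derivative_1 helicoid_has_derivative_2)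

section \<open>First and second fundamental forms\<close>

text \<open>The length of \<open>helicoid_s\<close>, which depends on \<open>t\<close> alone. It is
  also the area density, as \<open>helicoid_t\<close> is a unit vector orthogonal to
  \<open>helicoid_s\<close>.\<close>

definition speed :: "real \<Rightarrow> real \<Rightarrow> real" where
  "speed \<alpha> t = sqrt ((cosh t)\<^sup>2 + \<alpha>\<^sup>2 * (sinh t)\<^sup>2)"

lemma speed_squared: "(speed \<alpha> t)\<^sup>2 = (cosh t)\<^sup>2 + \<alpha>\<^sup>2 * (sinh t)\<^sup>2"
  by (simp add: speed_def)

lemma speed_ge_1: "1 \<le> speed \<alpha> t"
  unfolding speed_def using cosh_real_ge_1[of t] by (simp add: one_le_power add_increasing2)

lemma speed_pos [simp]: "0 < speed \<alpha> t" and speed_nonzero [simp]: "speed \<alpha> t \<noteq> 0"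
  using speed_ge_1[of \<alpha> t] by auto

lemma lorentz_commute: "lorentz x y = lorentz y x"
  by (simp add: lorentz_def mult.commute)

lemma hyp_trig_squares:
  fixes s t :: real
  shows "(cosh s)\<^sup>2 = (sinh s)\<^sup>2 + 1" "(sin t)\<^sup>2 + (cos t)\<^sup>2 = 1"
  by (simp_all add: cosh_square_eq)

lemma lorentz_helicoid:
  "lorentz (helicoid \<alpha> (s, t)) (helicoid \<alpha> (s, t)) = -1"
  "lorentz (helicoid_s \<alpha> (s, t)) (helicoid \<alpha> (s, t)) = 0"
  "lorentz (helicoid_t \<alpha> (s, t)) (helicoid \<alpha> (s, t)) = 0"
  "lorentz (helicoid_s \<alpha> (s, t)) (helicoid_s \<alpha> (s, t)) = (speed \<alpha> t)\<^sup>2"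
  "lorentz (helicoid_s \<alpha> (s, t)) (helicoid_t \<alpha> (s, t)) = 0"
  "lorentz (helicoid_t \<alpha> (s, t)) (helicoid_t \<alpha> (s, t)) = 1"
  "lorentz (helicoid_ss \<alpha> (s, t)) (helicoid \<alpha> (s, t)) = - (speed \<alpha> t)\<^sup>2"
  "lorentz (helicoid_ss \<alpha> (s, t)) (helicoid_s \<alpha> (s, t)) = 0"
  "lorentz (helicoid_ss \<alpha> (s, t)) (helicoid_t \<alpha> (s, t)) = - (1 + \<alpha>\<^sup>2) * sinh t * cosh t"
  "lorentz (helicoid_st \<alpha> (s, t)) (helicoid \<alpha> (s, t)) = 0"
  "lorentz (helicoid_st \<alpha> (s, t)) (helicoid_s \<alpha> (s, t)) = (1 + \<alpha>\<^sup>2) * sinh t * cosh t"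
  "lorentz (helicoid_st \<alpha> (s, t)) (helicoid_t \<alpha> (s, t)) = 0"
  "lorentz (helicoid_st \<alpha> (s, t)) (helicoid_st \<alpha> (s, t)) = (sinh t)\<^sup>2 + \<alpha>\<^sup>2 * (cosh t)\<^sup>2"
  unfolding helicoid_defs lorentz_def speed_squared split vector4_nth
  using hyp_trig_squares(1)[of s] hyp_trig_squares(1)[of t] hyp_trig_squares(2)[of "\<alpha> * s"]
  by - algebra+

lemma metric_helicoid:
  "metric (helicoid \<alpha>) (s, t) = (\<chi> i j. if i = j then if i = 1 then (speed \<alpha> t)\<^sup>2 else 1 else 0)"
  by (simp add: metric_def vec_eq_iff forall_2 lorentz_helicoid lorentz_commute[of "helicoid_t \<alpha> _"])

text \<open>\<open>matrix_inv\<close> is a choice among two-sided inverses, and uniqueness of the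
  inverse identifies it.\<close>

lemma matrix_inv_eqI:
  fixes A B :: "real ^ 'n ^ 'n"
  assumes "A ** B = mat 1" "B ** A = mat 1"
  shows "matrix_inv A = B"
proof -
  have "A ** matrix_inv A = mat 1 \<and> matrix_inv A ** A = mat 1"
    unfolding matrix_inv_def by (rule someI[of _ B]) (use assms in simp)
  then show ?thesis by (metis assms(1) matrix_mul_assoc matrix_mul_lid matrix_mul_rid)
qed

lemma inv_metric_helicoid:
  "inv_metric (helicoid \<alpha>) (s, t) = (\<chi> i j. if i = j then if i = 1 then 1 / (speed \<alpha> t)\<^sup>2 else 1 else 0)"
  unfolding inv_metric_def metric_helicoid
  by (rule matrix_inv_eqI)
    (simp_all add: vec_eq_iff forall_2 matrix_matrix_mult_def sum_2 mat_def)

lemma det_metric_helicoid: "det (metric (helicoid \<alpha>) (s, t)) = (speed \<alpha> t)\<^sup>2"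
  by (simp add: metric_helicoid det_2)

lemma normal_part_helicoid:
  "normal_part (helicoid \<alpha>) (s, t) v = v + lorentz v (helicoid \<alpha> (s, t)) *\<^sub>R helicoid \<alpha> (s, t)
    - (lorentz v (helicoid_s \<alpha> (s, t)) / (speed \<alpha> t)\<^sup>2) *\<^sub>R helicoid_s \<alpha> (s, t)
    - lorentz v (helicoid_t \<alpha> (s, t)) *\<^sub>R helicoid_t \<alpha> (s, t)"
  by (simp add: normal_part_def inv_metric_helicoid sum_2)

text \<open>Both coordinate directions are asymptotic: \<open>helicoid_ss\<close> is a combination
  of the position and \<open>helicoid_t\<close>, and the second derivative in \<open>t\<close> is
  the position itself. As the coordinates are orthogonal, minimality follows.\<close>

lemma second_ff_helicoid:
  "second_ff (helicoid \<alpha>) (s, t) 1 1 = 0"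
  "second_ff (helicoid \<alpha>) (s, t) 2 2 = 0"
  "second_ff (helicoid \<alpha>) (s, t) 1 2 = helicoid_st \<alpha> (s, t)
     - ((1 + \<alpha>\<^sup>2) * sinh t * cosh t / (speed \<alpha> t)\<^sup>2) *\<^sub>R helicoid_s \<alpha> (s, t)"
  "second_ff (helicoid \<alpha>) (s, t) 2 1 = helicoid_st \<alpha> (s, t)
     - ((1 + \<alpha>\<^sup>2) * sinh t * cosh t / (speed \<alpha> t)\<^sup>2) *\<^sub>R helicoid_s \<alpha> (s, t)"
proof -
  have c: "(cosh t)\<^sup>2 = (sinh t)\<^sup>2 + 1" by (rule hyp_trig_squares)
  show "second_ff (helicoid \<alpha>) (s, t) 1 1 = 0"
    unfolding second_ff_def partial_helicoid normal_part_helicoid lorentz_helicoid speed_squared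
    unfolding helicoid_defs vec_eq_iff forall_4
    by (simp only: split vector4_nth vector_minus_component vector_add_component vector_scaleR_component zero_index
        real_scaleR_def div_0 mult_zero_left diff_0_right)
      (intro conjI; use c in algebra)
  show "second_ff (helicoid \<alpha>) (s, t) 2 2 = 0"
    by (simp add: second_ff_def normal_part_helicoid lorentz_helicoid
        lorentz_commute[of "helicoid \<alpha> _"])
qed (simp_all add: second_ff_def normal_part_helicoid lorentz_helicoid)

lemma mean_curvature_helicoid: "mean_curvature (helicoid \<alpha>) (s, t) = 0"
  by (simp add: mean_curvature_def sum_2 inv_metric_helicoid second_ff_helicoid)

lemma second_ff_norm2_helicoid:
  "second_ff_norm2 (helicoid \<alpha>) (s, t) = 2 * \<alpha>\<^sup>2 / speed \<alpha> t ^ 4"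
proof -
  define k where "k = (1 + \<alpha>\<^sup>2) * sinh t * cosh t / (speed \<alpha> t)\<^sup>2"
  \<comment> \<open>\<open>v\<close> is the mixed entry of the second fundamental form. Only the two
    mixed entries survive, each weighted by the inverse metric in the \<open>s\<close> direction, so
    the norm is \<open>2 * lorentz v v\<close> divided by the square of
    \<open>speed\<close>.\<close>
  define v where "v = helicoid_st \<alpha> (s, t) - k *\<^sub>R helicoid_s \<alpha> (s, t)"
  have "lorentz v v = lorentz (helicoid_st \<alpha> (s, t)) (helicoid_st \<alpha> (s, t))
      - 2 * k * lorentz (helicoid_st \<alpha> (s, t)) (helicoid_s \<alpha> (s, t))
      + k\<^sup>2 * lorentz (helicoid_s \<alpha> (s, t)) (helicoid_s \<alpha> (s, t))"
    unfolding v_def lorentz_def by (simp add: algebra_simps power2_eq_square)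
  also have "\<dots> = (sinh t)\<^sup>2 + \<alpha>\<^sup>2 * (cosh t)\<^sup>2 - 2 * k * ((1 + \<alpha>\<^sup>2) * sinh t * cosh t)
      + k\<^sup>2 * (speed \<alpha> t)\<^sup>2"
    by (simp add: lorentz_helicoid)
  also have "(1 + \<alpha>\<^sup>2) * sinh t * cosh t = k * (speed \<alpha> t)\<^sup>2"
    by (simp add: k_def)
  also have "(sinh t)\<^sup>2 + \<alpha>\<^sup>2 * (cosh t)\<^sup>2 - 2 * k * (k * (speed \<alpha> t)\<^sup>2) + k\<^sup>2 * (speed \<alpha> t)\<^sup>2
      = ((speed \<alpha> t)\<^sup>2 * ((sinh t)\<^sup>2 + \<alpha>\<^sup>2 * (cosh t)\<^sup>2) - (k * (speed \<alpha> t)\<^sup>2)\<^sup>2) / (speed \<alpha> t)\<^sup>2"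
    by (simp add: field_simps power2_eq_square)
  also have "k * (speed \<alpha> t)\<^sup>2 = (1 + \<alpha>\<^sup>2) * sinh t * cosh t"
    by (simp add: k_def)
  \<comment> \<open>After expansion the left-hand side is \<open>\<alpha>\<^sup>2\<close> times the
    square of \<open>(cosh t)\<^sup>2 - (sinh t)\<^sup>2\<close>, which is 1.\<close>
  also have "(speed \<alpha> t)\<^sup>2 * ((sinh t)\<^sup>2 + \<alpha>\<^sup>2 * (cosh t)\<^sup>2) - ((1 + \<alpha>\<^sup>2) * sinh t * cosh t)\<^sup>2 = \<alpha>\<^sup>2"
    unfolding speed_squared using hyp_trig_squares(1)[of t] by algebra
  finally have "lorentz v v = \<alpha>\<^sup>2 / (speed \<alpha> t)\<^sup>2" .
  then show ?thesis
    unfolding second_ff_norm2_def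
    by (simp add: sum_2 inv_metric_helicoid second_ff_helicoid k_def[symmetric] v_def[symmetric])
      (simp add: lorentz_def field_simps power2_eq_square power4_eq_xxxx)
qed

section \<open>Embeddedness and minimality\<close>

lemma helicoid_in_hyperbolic_space: "helicoid \<alpha> p \<in> hyperbolic_space"
proof -
  obtain s t where p: "p = (s, t)" by (cases p)
  have "1 * 1 \<le> cosh s * cosh t"
    using cosh_real_ge_1[of s] cosh_real_ge_1[of t] by (intro mult_mono) auto
  then have "1 \<le> helicoid \<alpha> p $ 1" by (simp add: p helicoid_def)
  then show ?thesis by (simp add: hyperbolic_space_def lorentz_helicoid p)
qed

lemma has_derivative_hyp_trig:
  "((\<lambda>p. cosh (fst p)) has_derivative (\<lambda>h. fst h * sinh (fst p))) (at p)"
  "((\<lambda>p. sinh (fst p)) has_derivative (\<lambda>h. fst h * cosh (fst p))) (at p)"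
  "((\<lambda>p. cosh (snd p)) has_derivative (\<lambda>h. snd h * sinh (snd p))) (at p)"
  "((\<lambda>p. sinh (snd p)) has_derivative (\<lambda>h. snd h * cosh (snd p))) (at p)"
  "((\<lambda>p. cos (\<alpha> * fst p)) has_derivative (\<lambda>h. (\<alpha> * fst h) * (- sin (\<alpha> * fst p)))) (at p)"
  "((\<lambda>p. sin (\<alpha> * fst p)) has_derivative (\<lambda>h. (\<alpha> * fst h) * cos (\<alpha> * fst p))) (at p)"
  for p :: "real \<times> real"
  by (rule DERIV_compose_FDERIV;
      (rule has_field_derivative_cosh[OF DERIV_ident, simplified] has_field_derivative_sinh[OF DERIV_ident, simplified]
        DERIV_cos DERIV_sin | intro has_derivative_fst has_derivative_snd has_derivative_ident has_derivative_mult_right))+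

lemma helicoid_has_derivative:
  "(helicoid \<alpha> has_derivative (\<lambda>h. fst h *\<^sub>R helicoid_s \<alpha> p + snd h *\<^sub>R helicoid_t \<alpha> p)) (at p)"
proof -
  have eq: "(\<lambda>h. fst h *\<^sub>R helicoid_s \<alpha> p + snd h *\<^sub>R helicoid_t \<alpha> p) = (\<lambda>h. vector
     [cosh (fst p) * (snd h * sinh (snd p)) + fst h * sinh (fst p) * cosh (snd p),
      sinh (fst p) * (snd h * sinh (snd p)) + fst h * cosh (fst p) * cosh (snd p),
      cos (\<alpha> * fst p) * (snd h * cosh (snd p)) + (\<alpha> * fst h) * (- sin (\<alpha> * fst p)) * sinh (snd p),
      sin (\<alpha> * fst p) * (snd h * cosh (snd p)) + (\<alpha> * fst h) * cos (\<alpha> * fst p) * sinh (snd p)])"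
    by (simp add: fun_eq_iff vec_eq_iff forall_4 helicoid_defs case_prod_beta)
  show ?thesis
    unfolding eq unfolding helicoid_def case_prod_beta
    by (intro has_derivative_vector4 has_derivative_mult has_derivative_hyp_trig)
qed

lemma differentiable_vector4:
  assumes "f differentiable (at x)" "g differentiable (at x)" "h differentiable (at x)" "k differentiable (at x)"
  shows "(\<lambda>x. vector [f x, g x, h x, k x] :: real ^ 4) differentiable (at x)"
proof -
  obtain f' g' h' k' where "(f has_derivative f') (at x)" "(g has_derivative g') (at x)"
    "(h has_derivative h') (at x)" "(k has_derivative k') (at x)"
    using assms unfolding differentiable_def by blast
  then show ?thesis by (intro differentiableI[OF has_derivative_vector4])
qed

lemma helicoid_partials_differentiable:
  "helicoid_s \<alpha> differentiable (at p)" "helicoid_t \<alpha> differentiable (at p)"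
  unfolding helicoid_defs case_prod_beta
  by (intro differentiable_vector4 differentiable_mult differentiable_const
      has_derivative_hyp_trig[THEN differentiableI])+

lemma continuous_helicoid:
  "continuous_on S (helicoid \<alpha>)" "continuous_on S (helicoid_s \<alpha>)" "continuous_on S (helicoid_t \<alpha>)"
  "continuous_on S (helicoid_ss \<alpha>)" "continuous_on S (helicoid_st \<alpha>)"
  unfolding helicoid_defs case_prod_beta by (intro continuous_intros)+

lemma homeomorphism_helicoid:
  "\<exists>Y. homeomorphism UNIV (range (helicoid \<alpha>)) (helicoid \<alpha>) Y"
proof -
  \<comment> \<open>An explicit inverse: the root recovers \<open>cosh t\<close>, so the quotient is
    \<open>sinh s\<close>. Rotating the last two coordinates back by the angle
    \<open>\<alpha> * s\<close> then leaves \<open>sinh t\<close>.\<close>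
  define S where "S x = arsinh (x $ 2 / sqrt ((x $ 1)\<^sup>2 - (x $ 2)\<^sup>2))" for x :: "real ^ 4"
  define Y where "Y x = (S x, arsinh (cos (\<alpha> * S x) * x $ 3 + sin (\<alpha> * S x) * x $ 4))" for x
  have diff: "(helicoid \<alpha> (s, t) $ 1)\<^sup>2 - (helicoid \<alpha> (s, t) $ 2)\<^sup>2 = (cosh t)\<^sup>2" for s t
    unfolding helicoid_def split vector4_nth using hyp_trig_squares(1)[of s] by algebra
  have S: "S (helicoid \<alpha> (s, t)) = s" for s t
    unfolding S_def diff by (simp add: helicoid_def arsinh_sinh_real)
  have Y: "Y (helicoid \<alpha> (s, t)) = (s, t)" for s t
  proof -
    have "cos (\<alpha> * s) * (cos (\<alpha> * s) * sinh t) + sin (\<alpha> * s) * (sin (\<alpha> * s) * sinh t) = sinh t"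
      using hyp_trig_squares(2)[of "\<alpha> * s"] by algebra
    then show ?thesis unfolding Y_def S by (simp add: helicoid_def arsinh_sinh_real)
  qed
  have nz: "\<forall>x\<in>range (helicoid \<alpha>). sqrt ((x $ 1)\<^sup>2 - (x $ 2)\<^sup>2) \<noteq> 0"
  proof (clarify)
    fix s t assume "sqrt ((helicoid \<alpha> (s, t) $ 1)\<^sup>2 - (helicoid \<alpha> (s, t) $ 2)\<^sup>2) = 0"
    then show False unfolding diff by simp
  qed
  have "continuous_on (range (helicoid \<alpha>)) (\<lambda>x. x $ 2 / sqrt ((x $ 1)\<^sup>2 - (x $ 2)\<^sup>2))"
    by (rule continuous_on_divide[OF _ _ nz]) (intro continuous_intros)+
  then have S_cont: "continuous_on (range (helicoid \<alpha>)) S"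
    unfolding S_def by (rule continuous_on_compose2[OF continuous_on_arsinh[of UNIV]]) simp
  have "continuous_on (range (helicoid \<alpha>)) (\<lambda>x. cos (\<alpha> * S x) * x $ 3 + sin (\<alpha> * S x) * x $ 4)"
    by (intro continuous_intros S_cont)
  then have "continuous_on (range (helicoid \<alpha>)) Y"
    unfolding Y_def
    by (intro continuous_on_Pair S_cont continuous_on_compose2[OF continuous_on_arsinh[of UNIV]]) simp_all
  then have "homeomorphism UNIV (range (helicoid \<alpha>)) (helicoid \<alpha>) Y"
    using Y by (intro homeomorphismI continuous_helicoid(1)) auto
  then show ?thesis by (rule exI[of _ Y])
qed

lemma embedded_surface_helicoid: "embedded_surface (helicoid \<alpha>)"
  unfolding embedded_surface_def
proof (intro conjI allI)
  show "range (helicoid \<alpha>) \<subseteq> hyperbolic_space" using helicoid_in_hyperbolic_space by auto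
  show "helicoid \<alpha> differentiable_on UNIV"
    using helicoid_has_derivative by (auto simp: differentiable_on_def differentiable_def)
  show "partial i (helicoid \<alpha>) differentiable_on UNIV" for i :: 2
    using exhaust_2[of i] helicoid_partials_differentiable
    by (auto simp: differentiable_on_def)
  show "continuous_on UNIV (partial i (partial j (helicoid \<alpha>)))" for i j :: 2
    using exhaust_2[of i] exhaust_2[of j] continuous_helicoid by auto
  show "inj (frechet_derivative (helicoid \<alpha>) (at p))" for p
  proof -
    obtain s t where p: "p = (s, t)" by (cases p)
    let ?D = "\<lambda>h. fst h *\<^sub>R helicoid_s \<alpha> p + snd h *\<^sub>R helicoid_t \<alpha> p"
    have D: "frechet_derivative (helicoid \<alpha>) (at p) = ?D"
      by (rule frechet_derivative_at[OF helicoid_has_derivative, symmetric])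
    have lin: "linear ?D" using has_derivative_linear[OF helicoid_has_derivative] .
    have "h = 0" if "?D h = 0" for h
    proof -
      \<comment> \<open>The induced form is a sum of two squares with positive weights, so only
        \<open>h = 0\<close> is null.\<close>
      have "0 = lorentz (?D h) (?D h)" using that by (simp add: lorentz_def)
      also have "\<dots> = (fst h)\<^sup>2 * lorentz (helicoid_s \<alpha> p) (helicoid_s \<alpha> p)
          + 2 * fst h * snd h * lorentz (helicoid_s \<alpha> p) (helicoid_t \<alpha> p)
          + (snd h)\<^sup>2 * lorentz (helicoid_t \<alpha> p) (helicoid_t \<alpha> p)"
        by (simp add: lorentz_def algebra_simps power2_eq_square)
      also have "\<dots> = (fst h * speed \<alpha> t)\<^sup>2 + (snd h)\<^sup>2"
        by (simp add: p lorentz_helicoid power_mult_distrib)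
      finally have "fst h * speed \<alpha> t = 0 \<and> snd h = 0"
        by (metis sum_power2_eq_zero_iff)
      then show ?thesis by (auto simp: prod_eq_iff)
    qed
    then show ?thesis unfolding D using linear_injective_0[OF lin] by blast
  qed
  show "\<exists>Y. homeomorphism UNIV (range (helicoid \<alpha>)) (helicoid \<alpha>) Y" by (rule homeomorphism_helicoid)
qed

lemma minimal_surface_helicoid: "minimal_surface (helicoid \<alpha>)"
  using embedded_surface_helicoid mean_curvature_helicoid by (auto simp: minimal_surface_def)

section \<open>Curve length, intrinsic distance and test functions on the rulings\<close>

text \<open>Cauchy-Schwarz on the last three coordinates gives
  \<open>(x $ 1 * v $ 1)\<^sup>2 \<le> q * r\<close>, and the squared first coordinate of
  \<open>x\<close> is \<open>1 + q\<close>; hence \<open>r\<close> dominates the squared first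
  coordinate of \<open>v\<close>.\<close>

lemma lorentz_tangent_nonneg:
  assumes "lorentz x x = -1" "lorentz x v = 0"
  shows "0 \<le> lorentz v v"
proof -
  define q where "q = (x $ 2)\<^sup>2 + (x $ 3)\<^sup>2 + (x $ 4)\<^sup>2"
  define r where "r = (v $ 2)\<^sup>2 + (v $ 3)\<^sup>2 + (v $ 4)\<^sup>2"
  have x1: "(x $ 1)\<^sup>2 = 1 + q" and xv: "x $ 1 * v $ 1 = x $ 2 * v $ 2 + x $ 3 * v $ 3 + x $ 4 * v $ 4"
    using assms by (simp_all add: lorentz_def q_def power2_eq_square)
  \<comment> \<open>Lagrange's identity, the explicit defect in Cauchy-Schwarz.\<close>
  have "q * r - (x $ 1 * v $ 1)\<^sup>2 = (x $ 2 * v $ 3 - x $ 3 * v $ 2)\<^sup>2 + (x $ 2 * v $ 4 - x $ 4 * v $ 2)\<^sup>2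
      + (x $ 3 * v $ 4 - x $ 4 * v $ 3)\<^sup>2"
    unfolding xv q_def r_def by (simp add: power2_eq_square algebra_simps)
  then have "(x $ 1 * v $ 1)\<^sup>2 \<le> q * r" by (smt (verit) zero_le_power2)
  moreover have "0 \<le> q" "0 \<le> r" by (simp_all add: q_def r_def)
  ultimately have "(1 + q) * (v $ 1)\<^sup>2 \<le> (1 + q) * r"
    by (simp add: power_mult_distrib x1 algebra_simps)
  then have "(v $ 1)\<^sup>2 \<le> r" using \<open>0 \<le> q\<close> by (simp add: mult_le_cancel_left)
  then show ?thesis by (simp add: lorentz_def r_def power2_eq_square)
qed

lemma has_real_derivative_lorentz:
  assumes "(c has_vector_derivative v) (at r)"
  shows "((\<lambda>r. lorentz (c r) (c r)) has_real_derivative 2 * lorentz (c r) v) (at r)"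
proof -
  have "((\<lambda>r. c r $ i) has_real_derivative v $ i) (at r)" for i
    using bounded_linear.has_vector_derivative[OF bounded_linear_vec_nth assms]
    by (simp add: has_real_derivative_iff_has_vector_derivative)
  note [derivative_intros] = this
  show ?thesis
    unfolding lorentz_def by (auto intro!: derivative_eq_intros simp: algebra_simps)
qed

text \<open>\<open>sqrt\<close> is negative on negative numbers, so the sign of a length rests on
  velocities being spacelike: differentiating \<open>lorentz (c r) (c r) = -1\<close> makes them
  tangent to hyperbolic space. The result bounds from below the lengths whose infimum is
  \<open>intrinsic_dist\<close>.\<close>

lemma curve_length_nonneg:
  assumes "c C1_differentiable_on {0..1}" "c ` {0..1} \<subseteq> hyperbolic_space"
  shows "0 \<le> curve_length c"
proof -
  let ?f = "\<lambda>r. sqrt (lorentz (vector_derivative c (at r)) (vector_derivative c (at r)))"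
  have nonneg: "0 \<le> ?f r" if r: "r \<in> {0<..<1}" for r
  proof -
    define v where "v = vector_derivative c (at r)"
    have "c differentiable (at r)"
      using assms(1) r by (auto simp: C1_differentiable_on_eq)
    then have v: "(c has_vector_derivative v) (at r)"
      unfolding v_def by (simp add: vector_derivative_works)
    have const: "lorentz (c x) (c x) = -1" if "x \<in> {0<..<1}" for x
    proof -
      have "c x \<in> hyperbolic_space" using that by (intro subsetD[OF assms(2)] imageI) auto
      then show ?thesis by (simp add: hyperbolic_space_def)
    qed
    have "((\<lambda>_. -1) has_real_derivative 2 * lorentz (c r) v) (at r)"
      by (rule has_field_derivative_transform_within_open[OF has_real_derivative_lorentz[OF v] _ r])
        (use const in auto)
    then have "2 * lorentz (c r) v = 0" using DERIV_unique DERIV_const by blast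
    then have "0 \<le> lorentz v v"
      using const[OF r] by (intro lorentz_tangent_nonneg[of "c r"]) auto
    then show ?thesis by (simp add: v_def)
  qed
  \<comment> \<open>At 0 and 1 the two-sided derivative depends on values of \<open>c\<close>
    outside the unit interval, about which nothing is assumed; removing the endpoints keeps the
    integral.\<close>
  have "curve_length c = integral {0<..<1} ?f"
    by (simp add: curve_length_def integral_open_interval_real)
  \<comment> \<open>If the integrand is not integrable, the integral is 0 by convention.\<close>
  also have "\<dots> \<ge> 0"
    using nonneg by (cases "?f integrable_on {0<..<1}") (auto intro: integral_nonneg simp: not_integrable_integral)
  finally show ?thesis .
qed

lemma intrinsic_dist_bounds:
  assumes M: "M \<subseteq> hyperbolic_space"
    and c: "c C1_differentiable_on {0..1}" "c ` {0..1} \<subseteq> M" "c 0 = x" "c 1 = y"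
  shows "0 \<le> intrinsic_dist M x y" "intrinsic_dist M x y \<le> curve_length c"
proof -
  let ?A = "{curve_length c |c. c C1_differentiable_on {0..1} \<and> c ` {0..1} \<subseteq> M \<and> c 0 = x \<and> c 1 = y}"
  have mem: "curve_length c \<in> ?A" using c by blast
  have nonneg: "0 \<le> l" if "l \<in> ?A" for l
    using that curve_length_nonneg subset_trans[OF _ M] by blast
  show "0 \<le> intrinsic_dist M x y"
    unfolding intrinsic_dist_def using mem nonneg by (intro cInf_greatest) blast+
  show "intrinsic_dist M x y \<le> curve_length c"
    unfolding intrinsic_dist_def using mem nonneg by (intro cInf_lower bdd_belowI)
qed

text \<open>The competing curve runs along the ruling, where \<open>helicoid_t\<close> is a unit
  vector, so its length is the difference of the parameters.\<close>

lemma intrinsic_dist_helicoid: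
  "intrinsic_dist (range (helicoid \<alpha>)) (helicoid \<alpha> (s, t)) (helicoid \<alpha> (s, t')) \<le> \<bar>t' - t\<bar>"
  "0 \<le> intrinsic_dist (range (helicoid \<alpha>)) (helicoid \<alpha> (s, t)) (helicoid \<alpha> (s, t'))"
proof -
  define c where "c r = helicoid \<alpha> (s, t + r * (t' - t))" for r
  define D where "D r = (t' - t) *\<^sub>R helicoid_t \<alpha> (s, t + r * (t' - t))" for r
  have D: "(c has_vector_derivative D r) (at r)" for r
  proof -
    have "((\<lambda>r. t + r * (t' - t)) has_vector_derivative t' - t) (at r)"
      by (auto intro!: derivative_eq_intros simp: has_real_derivative_iff_has_vector_derivative[symmetric])
    from vector_diff_chain_at[OF this helicoid_has_derivative_2(1)]
    show ?thesis by (simp add: c_def[abs_def] D_def o_def)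
  qed
  have "continuous_on {0..1} D"
    unfolding D_def
    by (intro continuous_intros continuous_on_compose2[OF continuous_helicoid(3)[of UNIV]]) auto
  with D have C1: "c C1_differentiable_on {0..1}"
    unfolding C1_differentiable_on_def by blast
  have "vector_derivative c (at r) = D r" for r using D by (rule vector_derivative_at)
  moreover have "lorentz (D r) (D r) = (t' - t)\<^sup>2 * lorentz (helicoid_t \<alpha> (s, t + r * (t' - t)))
      (helicoid_t \<alpha> (s, t + r * (t' - t)))" for r
    unfolding D_def lorentz_def by (simp add: algebra_simps power2_eq_square)
  ultimately have len: "curve_length c = \<bar>t' - t\<bar>"
    by (simp add: curve_length_def lorentz_helicoid)
  have "range (helicoid \<alpha>) \<subseteq> hyperbolic_space" using helicoid_in_hyperbolic_space by auto
  note le = intrinsic_dist_bounds[OF this C1, of "helicoid \<alpha> (s, t)" "helicoid \<alpha> (s, t')"]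
  show "intrinsic_dist (range (helicoid \<alpha>)) (helicoid \<alpha> (s, t)) (helicoid \<alpha> (s, t')) \<le> \<bar>t' - t\<bar>"
    "0 \<le> intrinsic_dist (range (helicoid \<alpha>)) (helicoid \<alpha> (s, t)) (helicoid \<alpha> (s, t'))"
    using le unfolding len[symmetric] by (auto simp: c_def)
qed

lemma lipschitz_on_helicoid_rulings:
  assumes "lipschitz_on_surface (range (helicoid \<alpha>)) f"
  obtains L where "\<And>s. L-lipschitz_on UNIV (\<lambda>t. f (helicoid \<alpha> (s, t)))"
proof -
  obtain L where L: "\<And>x y. x \<in> range (helicoid \<alpha>) \<Longrightarrow> y \<in> range (helicoid \<alpha>) \<Longrightarrow>
      \<bar>f x - f y\<bar> \<le> L * intrinsic_dist (range (helicoid \<alpha>)) x y"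
    using assms unfolding lipschitz_on_surface_def by metis
  \<comment> \<open>The definition leaves the sign of \<open>L\<close> open, whereas
    \<open>lipschitz_on\<close> demands a nonnegative constant.\<close>
  have "\<bar>L\<bar>-lipschitz_on UNIV (\<lambda>t. f (helicoid \<alpha> (s, t)))" for s
  proof (rule lipschitz_onI)
    fix t t' :: real
    let ?d = "intrinsic_dist (range (helicoid \<alpha>)) (helicoid \<alpha> (s, t)) (helicoid \<alpha> (s, t'))"
    have "\<bar>f (helicoid \<alpha> (s, t)) - f (helicoid \<alpha> (s, t'))\<bar> \<le> L * ?d" by (rule L) auto
    also have "\<dots> \<le> \<bar>L\<bar> * ?d"
      using intrinsic_dist_helicoid(2) by (intro mult_right_mono) auto
    also have "\<dots> \<le> \<bar>L\<bar> * \<bar>t' - t\<bar>"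
      using intrinsic_dist_helicoid(1) by (intro mult_left_mono) auto
    finally show "dist (f (helicoid \<alpha> (s, t))) (f (helicoid \<alpha> (s, t'))) \<le> \<bar>L\<bar> * dist t t'"
      by (simp add: dist_real_def abs_minus_commute)
  qed auto
  then show thesis by (rule that)
qed

text \<open>The first coordinate is at least \<open>cosh t\<close>, hence at least
  \<open>\<bar>t\<bar> / 2\<close>, so a norm bound \<open>B\<close> on the support confines
  \<open>t\<close> to \<open>\<bar>t\<bar> \<le> 2 * B\<close>, uniformly in
  \<open>s\<close>.\<close>

lemma compactly_supported_helicoid_bound:
  assumes "compactly_supported_on (range (helicoid \<alpha>)) f"
  obtains R where "\<And>s t. R < \<bar>t\<bar> \<Longrightarrow> f (helicoid \<alpha> (s, t)) = 0"
proof -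
  obtain K where K: "compact K" "\<And>x. x \<in> range (helicoid \<alpha>) - K \<Longrightarrow> f x = 0"
    using assms unfolding compactly_supported_on_def by metis
  obtain B where B: "\<And>x. x \<in> K \<Longrightarrow> norm x \<le> B"
    using compact_imp_bounded[OF K(1)] by (auto simp: bounded_iff)
  have "f (helicoid \<alpha> (s, t)) = 0" if "2 * B < \<bar>t\<bar>" for s t
  proof -
    have "\<bar>t\<bar> \<le> 2 * cosh t"
    proof -
      have "1 + \<bar>t\<bar> \<le> exp \<bar>t\<bar>" by (rule exp_ge_add_one_self)
      also have "\<dots> \<le> exp t + exp (- t)" by (simp add: abs_if)
      also have "\<dots> = 2 * cosh t" by (simp add: cosh_def)
      finally show ?thesis by simp
    qed
    moreover have "1 * cosh t \<le> cosh s * cosh t"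
      using cosh_real_ge_1[of s] by (intro mult_right_mono) auto
    moreover have "\<bar>helicoid \<alpha> (s, t) $ 1\<bar> \<le> norm (helicoid \<alpha> (s, t))"
      by (rule component_le_norm_cart)
    moreover have "\<bar>helicoid \<alpha> (s, t) $ 1\<bar> = cosh s * cosh t"
      by (simp add: helicoid_def abs_mult)
    ultimately have "B < norm (helicoid \<alpha> (s, t))"
      using that by linarith
    then show ?thesis using B K(2) by fastforce
  qed
  then show thesis by (rule that)
qed


section \<open>The stability inequality\<close>

definition speed' :: "real \<Rightarrow> real \<Rightarrow> real" where
  "speed' \<alpha> t = (1 + \<alpha>\<^sup>2) * sinh t * cosh t / speed \<alpha> t"

lemma speed_has_derivative: "(speed \<alpha> has_real_derivative speed' \<alpha> t) (at t)"
proof -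
  have "0 < (cosh t)\<^sup>2 + \<alpha>\<^sup>2 * (sinh t)\<^sup>2"
    by (intro add_pos_nonneg) auto
  then have "((\<lambda>t. sqrt ((cosh t)\<^sup>2 + \<alpha>\<^sup>2 * (sinh t)\<^sup>2)) has_real_derivative
      (2 * cosh t * sinh t + \<alpha>\<^sup>2 * (2 * sinh t * cosh t)) * (inverse (sqrt ((cosh t)\<^sup>2 + \<alpha>\<^sup>2 * (sinh t)\<^sup>2)) / 2)) (at t)"
    by (auto intro!: derivative_eq_intros)
  moreover have "(2 * cosh t * sinh t + \<alpha>\<^sup>2 * (2 * sinh t * cosh t)) * (inverse (speed \<alpha> t) / 2) = speed' \<alpha> t"
    by (simp add: speed'_def field_simps)
  ultimately show ?thesis
    by (simp add: speed_def[abs_def])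
qed

text \<open>With w for \<open>speed\<close>,
  \<open>(1 + \<alpha>\<^sup>2) * (sinh t)\<^sup>2\<close> is w^2 - 1 and
  \<open>(1 + \<alpha>\<^sup>2) * (cosh t)\<^sup>2\<close> is w^2 + \<alpha>^2, so the squared
  numerator of \<open>speed'\<close> factors as (w^2 - 1)(w^2 + \<alpha>^2).\<close>

lemma speed'_squared: "(speed' \<alpha> t)\<^sup>2 = (speed \<alpha> t)\<^sup>2 + (\<alpha>\<^sup>2 - 1) - \<alpha>\<^sup>2 / (speed \<alpha> t)\<^sup>2"
proof -
  have "((1 + \<alpha>\<^sup>2) * sinh t * cosh t)\<^sup>2 = ((speed \<alpha> t)\<^sup>2 + (\<alpha>\<^sup>2 - 1)) * (speed \<alpha> t)\<^sup>2 - \<alpha>\<^sup>2"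
    unfolding speed_squared using hyp_trig_squares(1)[of t] by algebra
  then show ?thesis
    by (simp add: speed'_def power_divide field_simps)
qed

text \<open>The numerator of \<open>speed'\<close> is w w' and has derivative 2 w^2 + \<alpha>^2 -
  1, so the quotient rule gives (2 w^2 + \<alpha>^2 - 1 - w'^2) / w; \<open>speed'_squared\<close>
  eliminates w'.\<close>

lemma speed'_has_derivative:
  "(speed' \<alpha> has_real_derivative speed \<alpha> t + \<alpha>\<^sup>2 / speed \<alpha> t ^ 3) (at t)"
proof -
  have "((\<lambda>t. (1 + \<alpha>\<^sup>2) * sinh t * cosh t / speed \<alpha> t) has_real_derivative
      (((1 + \<alpha>\<^sup>2) * cosh t * cosh t + (1 + \<alpha>\<^sup>2) * sinh t * sinh t) * speed \<alpha> t
        - (1 + \<alpha>\<^sup>2) * sinh t * cosh t * speed' \<alpha> t) / (speed \<alpha> t * speed \<alpha> t)) (at t)"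
    by (auto intro!: derivative_eq_intros speed_has_derivative)
  moreover have "(1 + \<alpha>\<^sup>2) * cosh t * cosh t + (1 + \<alpha>\<^sup>2) * sinh t * sinh t = 2 * (speed \<alpha> t)\<^sup>2 + (\<alpha>\<^sup>2 - 1)"
    unfolding speed_squared using hyp_trig_squares(1)[of t] by algebra
  moreover have "(1 + \<alpha>\<^sup>2) * sinh t * cosh t = speed \<alpha> t * speed' \<alpha> t"
    by (simp add: speed'_def)
  moreover have "((2 * (speed \<alpha> t)\<^sup>2 + (\<alpha>\<^sup>2 - 1)) * speed \<alpha> t - speed \<alpha> t * speed' \<alpha> t * speed' \<alpha> t)
      / (speed \<alpha> t * speed \<alpha> t) = (2 * (speed \<alpha> t)\<^sup>2 + (\<alpha>\<^sup>2 - 1) - (speed' \<alpha> t)\<^sup>2) / speed \<alpha> t"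
    by (simp add: field_simps power2_eq_square)
  moreover have "(2 * (speed \<alpha> t)\<^sup>2 + (\<alpha>\<^sup>2 - 1) - (speed' \<alpha> t)\<^sup>2) / speed \<alpha> t
      = speed \<alpha> t + \<alpha>\<^sup>2 / speed \<alpha> t ^ 3"
    unfolding speed'_squared by (simp add: field_simps power2_eq_square power3_eq_cube)
  ultimately show ?thesis
    unfolding speed'_def[abs_def] by simp
qed

text \<open>
  The left-hand side is minus the derivative of \<open>speed' \<cdot> f\<^sup>2\<close> when \<open>d\<close> is the derivative of \<open>f\<close>.
  The inequality is \<open>w (d + w' f / w)\<^sup>2 \<ge> 0\<close> for \<open>w = speed\<close>, plus \<open>2 w\<^sup>2 \<ge> \<alpha>\<^sup>2 - 1\<close>.
\<close>

lemma jacobi_pointwise: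
  assumes "\<alpha>\<^sup>2 \<le> 3"
  shows "- ((speed \<alpha> t + \<alpha>\<^sup>2 / speed \<alpha> t ^ 3) * f\<^sup>2 + speed' \<alpha> t * (2 * f * d))
    \<le> speed \<alpha> t * d\<^sup>2 - (2 * \<alpha>\<^sup>2 / speed \<alpha> t ^ 3 - 2 * speed \<alpha> t) * f\<^sup>2"
proof -
  define w where "w = speed \<alpha> t"
  define w' where "w' = speed' \<alpha> t"
  have w: "1 \<le> w" by (simp add: w_def speed_ge_1)
  have w': "w'\<^sup>2 = w\<^sup>2 + (\<alpha>\<^sup>2 - 1) - \<alpha>\<^sup>2 / w\<^sup>2"
    by (simp add: w_def w'_def speed'_squared)
  define a b where "a = \<alpha>\<^sup>2 / w ^ 3" and "b = (\<alpha>\<^sup>2 - 1) / w"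
  have q: "w'\<^sup>2 / w = w + b - a"
    unfolding w' a_def b_def using w by (simp add: field_simps power2_eq_square power3_eq_cube)
  have a2: "2 * \<alpha>\<^sup>2 / w ^ 3 = 2 * a" by (simp add: a_def)
  have "w * d\<^sup>2 - (2 * \<alpha>\<^sup>2 / w ^ 3 - 2 * w) * f\<^sup>2 + ((w + \<alpha>\<^sup>2 / w ^ 3) * f\<^sup>2 + w' * (2 * f * d))
      = (w * d\<^sup>2 + 2 * w' * f * d + (w'\<^sup>2 / w) * f\<^sup>2) + (2 * w - (\<alpha>\<^sup>2 - 1) / w) * f\<^sup>2"
    unfolding q a2 a_def[symmetric] b_def[symmetric] by (simp add: algebra_simps)
  also have "w * d\<^sup>2 + 2 * w' * f * d + (w'\<^sup>2 / w) * f\<^sup>2 = w * (d + w' * f / w)\<^sup>2"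
    using w by (simp add: field_simps power2_eq_square)
  also have "0 \<le> w * (d + w' * f / w)\<^sup>2 + (2 * w - (\<alpha>\<^sup>2 - 1) / w) * f\<^sup>2"
  proof -
    have "\<alpha>\<^sup>2 - 1 \<le> 2 * w * w" using assms mult_mono[of 1 w 1 w] w by simp
    then have "(\<alpha>\<^sup>2 - 1) / w \<le> 2 * w" using w by (simp add: divide_le_eq)
    then show ?thesis using w by (intro add_nonneg_nonneg mult_nonneg_nonneg) auto
  qed
  finally show ?thesis by (simp add: w_def w'_def)
qed

text \<open>The factor \<open>k\<close> need not be globally Lipschitz, but the product only sees a
  compact interval: composing with the 1-Lipschitz map \<open>clamp\<close> leaves it unchanged, and
  on the interval the product rule estimate applies with bounds on \<open>k\<close>,
  \<open>k'\<close> and \<open>f\<close>.\<close>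

lemma lipschitz_on_product_compact_support:
  fixes f k :: "real \<Rightarrow> real"
  assumes lip: "L-lipschitz_on UNIV f" and supp: "\<And>t. R < \<bar>t\<bar> \<Longrightarrow> f t = 0"
    and k: "\<And>t. (k has_real_derivative k' t) (at t)" and k': "continuous_on UNIV k'"
  obtains M where "M-lipschitz_on UNIV (\<lambda>t. k t * (f t)\<^sup>2)"
proof -
  \<comment> \<open>The absolute value keeps the interval nonempty for negative \<open>R\<close>;
    the extra 1 puts its endpoints strictly beyond \<open>R\<close>, so that \<open>f\<close>
    vanishes at clamped points too.\<close>
  define S where "S = \<bar>R\<bar> + 1"
  define clamp where "clamp t = max (- S) (min S t)" for t
  have S: "0 < S" by (simp add: S_def)
  have clamp: "clamp t \<in> {-S..S}" "\<bar>clamp t - clamp t'\<bar> \<le> \<bar>t - t'\<bar>" for t t'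
    using S by (auto simp: clamp_def)
  have k_cont: "continuous_on UNIV k"
    using k by (meson DERIV_isCont continuous_at_imp_continuous_on)
  have f_cont: "continuous_on UNIV f" using lip by (rule lipschitz_on_continuous_on)
  have bound: "\<exists>B>0. \<forall>t\<in>{-S..S}. \<bar>g t\<bar> \<le> B" if "continuous_on UNIV g" for g :: "real \<Rightarrow> real"
  proof -
    have "compact (g ` {-S..S})"
      using that by (intro compact_continuous_image) (auto intro: continuous_on_subset)
    then obtain B where "B > 0" "\<forall>y\<in>g ` {-S..S}. norm y \<le> B"
      by (meson compact_imp_bounded bounded_pos)
    then show ?thesis by (auto intro!: exI[of _ B])
  qed
  obtain A where A: "A > 0" "\<And>t. t \<in> {-S..S} \<Longrightarrow> \<bar>k t\<bar> \<le> A" using bound[OF k_cont] by blast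
  obtain B where B: "B > 0" "\<And>t. t \<in> {-S..S} \<Longrightarrow> \<bar>f t\<bar> \<le> B" using bound[OF f_cont] by blast
  obtain C where C: "C > 0" "\<And>t. t \<in> {-S..S} \<Longrightarrow> \<bar>k' t\<bar> \<le> C" using bound[OF k'] by blast
  have L: "0 \<le> L" using lip by (rule lipschitz_on_nonneg)
  have k_lip: "\<bar>k x - k y\<bar> \<le> C * \<bar>x - y\<bar>" if "x \<in> {-S..S}" "y \<in> {-S..S}" for x y
    using field_differentiable_bound[of "{-S..S}" k k' C x y] k C that
    by (simp add: has_field_derivative_at_within)
  define M where "M = C * B\<^sup>2 + A * (2 * B * L)"
  have "M-lipschitz_on UNIV (\<lambda>t. k t * (f t)\<^sup>2)"
  proof (rule lipschitz_onI)
    fix x y :: real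
    have ext: "k t * (f t)\<^sup>2 = k (clamp t) * (f (clamp t))\<^sup>2" for t
    proof (cases "t \<in> {-S..S}")
      case True
      then have "clamp t = t" by (auto simp: clamp_def)
      then show ?thesis by simp
    next
      case False
      then have "R < \<bar>t\<bar>" "R < \<bar>clamp t\<bar>" by (auto simp: clamp_def S_def)
      then show ?thesis using supp by simp
    qed
    define u v where "u = clamp x" and "v = clamp y"
    have uv: "u \<in> {-S..S}" "v \<in> {-S..S}" "\<bar>u - v\<bar> \<le> \<bar>x - y\<bar>"
      unfolding u_def v_def by (rule clamp)+
    have "k u * (f u)\<^sup>2 - k v * (f v)\<^sup>2 = (k u - k v) * (f u)\<^sup>2 + k v * ((f u + f v) * (f u - f v))"
      by (simp add: algebra_simps power2_eq_square)
    also have "\<bar>\<dots>\<bar> \<le> \<bar>k u - k v\<bar> * \<bar>f u\<bar>\<^sup>2 + \<bar>k v\<bar> * (\<bar>f u + f v\<bar> * \<bar>f u - f v\<bar>)"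
      by (rule order_trans[OF abs_triangle_ineq]) (simp add: abs_mult)
    also have "\<dots> \<le> (C * \<bar>u - v\<bar>) * B\<^sup>2 + A * ((2 * B) * (L * \<bar>u - v\<bar>))"
    proof (intro add_mono mult_mono)
      show "\<bar>f u + f v\<bar> \<le> 2 * B" using B(2)[OF uv(1)] B(2)[OF uv(2)] by simp
      show "\<bar>f u - f v\<bar> \<le> L * \<bar>u - v\<bar>" using lipschitz_onD[OF lip, of u v] by (simp add: dist_real_def)
      show "\<bar>f u\<bar>\<^sup>2 \<le> B\<^sup>2" using B(2)[OF uv(1)] by (intro power_mono) auto
    qed (use k_lip uv A B C L in auto)
    also have "\<dots> = M * \<bar>u - v\<bar>" by (simp add: M_def algebra_simps)
    also have "\<dots> \<le> M * \<bar>x - y\<bar>" using uv(3) A B C L by (intro mult_left_mono) (auto simp: M_def)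
    finally show "dist (k x * (f x)\<^sup>2) (k y * (f y)\<^sup>2) \<le> M * dist x y"
      unfolding dist_real_def ext[of x] ext[of y] u_def v_def .
  qed (use A B C L in \<open>auto simp: M_def\<close>)
  then show thesis by (rule that)
qed

text \<open>By \<open>jacobi_pointwise\<close>, \<open>v\<close> dominates almost everywhere minus
  the derivative of \<open>speed' \<alpha> t * (f t)\<^sup>2\<close>; this product is Lipschitz with
  compact support, so that derivative integrates to zero. Quantifying over \<open>d\<close> in
  \<open>ge\<close> claims nothing where \<open>f\<close> is not differentiable.\<close>

lemma ruling_integral_nonneg:
  fixes f v :: "real \<Rightarrow> real"
  assumes "\<alpha>\<^sup>2 \<le> 3" and lip: "L-lipschitz_on UNIV f" and supp: "\<And>t. R < \<bar>t\<bar> \<Longrightarrow> f t = 0"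
    and v: "integrable lborel v"
    and ge: "AE t in lborel. \<forall>d. (f has_real_derivative d) (at t) \<longrightarrow>
      speed \<alpha> t * d\<^sup>2 - (2 * \<alpha>\<^sup>2 / speed \<alpha> t ^ 3 - 2 * speed \<alpha> t) * (f t)\<^sup>2 \<le> v t"
  shows "0 \<le> (\<integral>t. v t \<partial>lborel)"
proof -
  let ?k' = "\<lambda>t. speed \<alpha> t + \<alpha>\<^sup>2 / speed \<alpha> t ^ 3"
  have "continuous_on UNIV (speed \<alpha>)"
    using speed_has_derivative by (meson DERIV_isCont continuous_at_imp_continuous_on)
  then have "continuous_on UNIV ?k'"
    by (intro continuous_intros) auto
  then obtain M where M: "M-lipschitz_on UNIV (\<lambda>t. speed' \<alpha> t * (f t)\<^sup>2)"
    using lipschitz_on_product_compact_support[OF lip supp speed'_has_derivative] by metis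
  then obtain D where D: "integrable lborel D" "(\<integral>t. D t \<partial>lborel) = 0"
    "AE t in lborel. ((\<lambda>t. speed' \<alpha> t * (f t)\<^sup>2) has_real_derivative D t) (at t)"
    using supp by (elim lipschitz_compact_support_derivative[where R = R]) auto
  obtain d where d: "AE t in lborel. (f has_real_derivative d t) (at t)"
    using lipschitz_compact_support_derivative[OF lip supp] by metis
  have "AE t in lborel. - D t \<le> v t"
    using D(3) d ge
  proof eventually_elim
    case (elim t)
    have "((\<lambda>t. speed' \<alpha> t * (f t)\<^sup>2) has_real_derivative
        (?k' t * (f t)\<^sup>2 + speed' \<alpha> t * (2 * f t * d t))) (at t)"
      using elim(2) by (auto intro!: derivative_eq_intros speed'_has_derivative)
    with elim(1) have "D t = ?k' t * (f t)\<^sup>2 + speed' \<alpha> t * (2 * f t * d t)"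
      by (rule DERIV_unique)
    with jacobi_pointwise[OF assms(1), of t "f t" "d t"] elim(2,3) show ?case by fastforce
  qed
  then have "(\<integral>t. - D t \<partial>lborel) \<le> (\<integral>t. v t \<partial>lborel)"
    using D(1) v by (intro integral_mono_AE) auto
  then show ?thesis using D by simp
qed

section \<open>Integration over the rulings and conclusion\<close>

text \<open>Fubini for an integrand whose measurability is unknown. If \<open>u\<close> is not
  integrable, its integral is 0 by convention; otherwise a Borel version \<open>u'\<close> agrees
  with it almost everywhere, and the fibres of \<open>u'\<close> serve as \<open>v\<close> for
  almost every \<open>s\<close>.\<close>

lemma lebesgue_integral_nonneg_fibres:
  fixes u :: "real \<times> real \<Rightarrow> real"
  assumes "\<And>s v. integrable lborel v \<Longrightarrow> AE t in lborel. u (s, t) = v t \<Longrightarrow> 0 \<le> (\<integral>t. v t \<partial>lborel)"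
  shows "0 \<le> (\<integral>p. u p \<partial>lebesgue)"
proof (cases "integrable lebesgue u")
  case True
  then obtain u' where u': "u' \<in> borel_measurable lborel" "AE p in lborel. u p = u' p"
    using completion_ex_borel_measurable_real[of u lborel] by auto
  have ae: "AE p in lebesgue. u p = u' p" using u'(2) by (rule AE_completion)
  have u'_leb: "u' \<in> borel_measurable lebesgue" using u'(1) by (rule measurable_completion)
  have "integrable lebesgue u'"
    using True ae u'_leb borel_measurable_integrable[OF True] by (subst (asm) integrable_cong_AE) auto
  then have int: "integrable lborel u'" using u'(1) integrable_completion by blast
  then have int': "integrable (lborel \<Otimes>\<^sub>M lborel) u'" by (simp add: lborel_prod)
  have "(\<integral>p. u p \<partial>lebesgue) = (\<integral>p. u' p \<partial>lebesgue)"
    using ae u'_leb borel_measurable_integrable[OF True] by (intro integral_cong_AE) auto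
  also have "\<dots> = (\<integral>p. u' p \<partial>lborel)" using u'(1) by (rule integral_completion)
  also have "\<dots> = (\<integral>s. (\<integral>t. u' (s, t) \<partial>lborel) \<partial>lborel)"
    using lborel_pair.integral_fst'[OF int'] by (simp add: lborel_prod)
  also have "\<dots> \<ge> 0"
  proof (rule integral_nonneg_AE)
    have "AE p in lborel \<Otimes>\<^sub>M lborel. u p = u' p"
      unfolding lborel_prod by (rule u'(2))
    then have "AE s in lborel. AE t in lborel. u (s, t) = u' (s, t)"
      by (rule lborel_pair.AE_pair)
    with lborel_pair.AE_integrable_fst'[OF int']
    show "AE s in lborel. 0 \<le> (\<integral>t. u' (s, t) \<partial>lborel)"
      by eventually_elim (rule assms)
  qed
  finally show ?thesis .
qed (simp add: not_integrable_integral_eq)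

theorem theorem5p1:
  fixes \<alpha> :: real
  assumes "\<bar>\<alpha>\<bar>\<^sup>2 \<le> 9 / 8"
  shows "stable_minimal_surface (helicoid \<alpha>)"
  unfolding stable_minimal_surface_def
proof (intro conjI allI impI)
  show "minimal_surface (helicoid \<alpha>)" by (rule minimal_surface_helicoid)
  fix f assume f: "lipschitz_on_surface (range (helicoid \<alpha>)) f \<and> compactly_supported_on (range (helicoid \<alpha>)) f"
  have "\<alpha>\<^sup>2 \<le> 3" using assms by simp
  obtain L where L: "\<And>s. L-lipschitz_on UNIV (\<lambda>t. f (helicoid \<alpha> (s, t)))"
    using f lipschitz_on_helicoid_rulings by blast
  obtain R where R: "\<And>s t. R < \<bar>t\<bar> \<Longrightarrow> f (helicoid \<alpha> (s, t)) = 0"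
    using f compactly_supported_helicoid_bound by blast
  let ?u = "\<lambda>p. (grad_norm2 (helicoid \<alpha>) f p - (second_ff_norm2 (helicoid \<alpha>) p - 2) * (f (helicoid \<alpha> p))\<^sup>2)
    * sqrt (det (metric (helicoid \<alpha>) p))"
  \<comment> \<open>The gap between the two sides is the weighted square of the derivative in
    \<open>s\<close>; the factor \<open>speed\<close> comes from the area density.\<close>
  have u_ge: "speed \<alpha> t * d\<^sup>2 - (2 * \<alpha>\<^sup>2 / speed \<alpha> t ^ 3 - 2 * speed \<alpha> t) * (f (helicoid \<alpha> (s, t)))\<^sup>2 \<le> ?u (s, t)"
    if d: "((\<lambda>t. f (helicoid \<alpha> (s, t))) has_real_derivative d) (at t)" for s t d
  proof -
    have "partial 2 (f \<circ> helicoid \<alpha>) (s, t) = d"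
      using d by (intro partial_2_eqI) (simp add: has_real_derivative_iff_has_vector_derivative)
    then have "grad_norm2 (helicoid \<alpha>) f (s, t) = (partial 1 (f \<circ> helicoid \<alpha>) (s, t) / speed \<alpha> t)\<^sup>2 + d\<^sup>2"
      by (simp add: grad_norm2_def sum_2 inv_metric_helicoid power2_eq_square)
    moreover have "sqrt (det (metric (helicoid \<alpha>) (s, t))) = speed \<alpha> t"
      by (rule real_sqrt_unique[OF det_metric_helicoid[symmetric] less_imp_le[OF speed_pos]])
    ultimately have "?u (s, t) = speed \<alpha> t * (partial 1 (f \<circ> helicoid \<alpha>) (s, t) / speed \<alpha> t)\<^sup>2
        + (speed \<alpha> t * d\<^sup>2 - (2 * \<alpha>\<^sup>2 / speed \<alpha> t ^ 3 - 2 * speed \<alpha> t) * (f (helicoid \<alpha> (s, t)))\<^sup>2)"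
      by (simp add: second_ff_norm2_helicoid algebra_simps power3_eq_cube power4_eq_xxxx)
    \<comment> \<open>This holds even where the derivative in \<open>s\<close> does not exist and
      \<open>partial\<close> has an unspecified value.\<close>
    moreover have "0 \<le> speed \<alpha> t * (partial 1 (f \<circ> helicoid \<alpha>) (s, t) / speed \<alpha> t)\<^sup>2"
      by (intro mult_nonneg_nonneg less_imp_le[OF speed_pos] zero_le_power2)
    ultimately show ?thesis by linarith
  qed
  show "0 \<le> area_integral (helicoid \<alpha>)
      (\<lambda>p. grad_norm2 (helicoid \<alpha>) f p - (second_ff_norm2 (helicoid \<alpha>) p - 2) * (f (helicoid \<alpha> p))\<^sup>2)"
    unfolding area_integral_def
  proof (rule lebesgue_integral_nonneg_fibres)
    fix s v assume v: "integrable lborel v" "AE t in lborel. ?u (s, t) = v t"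
    show "0 \<le> (\<integral>t. v t \<partial>lborel)"
    proof (rule ruling_integral_nonneg[OF \<open>\<alpha>\<^sup>2 \<le> 3\<close> L R v(1)])
      show "AE t in lborel. \<forall>d. ((\<lambda>t. f (helicoid \<alpha> (s, t))) has_real_derivative d) (at t) \<longrightarrow>
          speed \<alpha> t * d\<^sup>2 - (2 * \<alpha>\<^sup>2 / speed \<alpha> t ^ 3 - 2 * speed \<alpha> t) * (f (helicoid \<alpha> (s, t)))\<^sup>2 \<le> v t"
        using v(2)
      proof eventually_elim
        case (elim t)
        show ?case unfolding elim[symmetric] by (intro allI impI u_ge)
      qed
    qed
  qed
qed

end
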